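(* Let $(X,x)$ be a pointed topological space. Then for every integer $k\ge 1$, the $k$th shape group $\check{\pi}_k(X,x)$, equipped with its shape topology (i.e. $\check{\pi}_k^{top}(X,x)$), is a topological group.
   Context: $\mathrm{HTop}_*$ is the pointed homotopy category of pointed topological spaces; $\mathrm{HPol}_*$ is its full subcategory of pointed spaces having the pointed homotopy type of a pointed polyhedron. Inverse systems are indexed by directed sets. An $\mathrm{HPol}_*$-expansion of $(X,x)$ is an inverse system $(\mathbf{X},\mathbf{x})=((X_\lambda,x_\lambda),p_{\lambda\lambda'},\Lambda)$ in $\mathrm{HPol}_*$ with a morphism $\mathbf{p}=(p_\lambda):(X,x)\to(\mathbf{X},\mathbf{x})$ of pro-$\mathrm{HTop}_*$ (so $p_{\lambda\lambda'}p_{\lambda'}=p_\lambda$ in $\mathrm{HTop}_*$ for $\lambda\le\lambda'$) such that: (E1) for every $P\in \mathrm{HPol}_*$ and every $h:(X,x)\to P$ in $\mathrm{HTop}_*$ there are $\lambda\in\Lambda$ and $f:(X_\lambda,x_\lambda)\to P$ with $fp_\lambda= h$ in $\mathrm{HTop}_*$; (E2) if $f_0,f_1:(X_\lambda,x_\lambda)\to P$ satisfy $f_0p_\lambda= f_1p_\lambda$, then $f_0p_{\lambda\lambda'}= f_1p_{\lambda\lambda'}$ for some $\lambda'\ge\lambda$. Every pointed space admits such an expansion. The pointed shape category has pointed spaces as objects; a shape morphism $(Y,y)\to(X,x)$ is represented by a morphism in pro-$\mathrm{HTop}_*$ between $\mathrm{HPol}_*$-expansions of $(Y,y)$ and $(X,x)$,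 where representatives for different expansions are identified via the canonical isomorphisms of expansions. Thus, with an expansion of $(X,x)$ fixed, a shape morphism $F:(S^k,* )\to(X,x)$ is a family $(f_\lambda)_{\lambda\in\Lambda}$ of pointed homotopy classes $f_\lambda:(S^k,* )\to(X_\lambda,x_\lambda)$ with $p_{\lambda\lambda'}f_{\lambda'}=f_\lambda$ for $\lambda\le\lambda'$, and $p_\lambda\circ F=f_\lambda$. The set of these is $Sh((S^k,* ),(X,x))$. The $k$th shape group is $\check{\pi}_k(X,x)=Sh((S^k,* ),(X,x))$ with operation $F+G$ represented by $(f_\lambda+g_\lambda)_\lambda$, where $f_\lambda+g_\lambda$ is the product in $\pi_k(X_\lambda,x_\lambda)$. The topological shape group $\check{\pi}_k^{top}(X,x)$ is this group with the topology having as basis the sets $V_\lambda^F=\{G\in Sh((S^k,* ),(X,x)) : p_\lambda\circ F=p_\lambda\circ G \text{ as pointed homotopy classes to } X_\lambda\}$, for $F\in Sh((S^k,* ),(X,x))$ and $\lambda\in\Lambda$. This topology does not depend on the choice of expansion. *)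

theory Defs
  imports "HOL-Analysis.Analysis" "HOL-Algebra.Group"
begin

section \<open>The pointed homotopy category\<close>

type_synonym 'a pspace = "'a topology \<times> 'a"

definition pointed_space :: "'a pspace \<Rightarrow> bool" where
  "pointed_space X \<longleftrightarrow> snd X \<in> topspace (fst X)"

definition pmap :: "'a pspace \<Rightarrow> 'b pspace \<Rightarrow> ('a \<Rightarrow> 'b) \<Rightarrow> bool" where
  "pmap X Y f \<longleftrightarrow> continuous_map (fst X) (fst Y) f \<and> f (snd X) = snd Y"

definition phomotopic :: "'a pspace \<Rightarrow> 'b pspace \<Rightarrow> ('a \<Rightarrow> 'b) \<Rightarrow> ('a \<Rightarrow> 'b) \<Rightarrow> bool" where
  "phomotopic X Y f g \<longleftrightarrow> homotopic_with (\<lambda>h. h (snd X) = snd Y) (fst X) (fst Y) f g"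

text \<open>
  A morphism of the pointed homotopy category is a class of (total) functions. The values of a
  function outside the space are irrelevant for \<^const>\<open>homotopic_with\<close>, so functions agreeing on the
  space lie in the same class.
\<close>

definition pclass :: "'a pspace \<Rightarrow> 'b pspace \<Rightarrow> ('a \<Rightarrow> 'b) \<Rightarrow> ('a \<Rightarrow> 'b) set" where
  "pclass X Y f = {g. phomotopic X Y f g}"

definition HTop :: "'a pspace \<Rightarrow> 'b pspace \<Rightarrow> ('a \<Rightarrow> 'b) set set" where
  "HTop X Y = pclass X Y ` {f. pmap X Y f}"

text \<open>
  \<open>hcomp X Z B A\<close> is the composite \<open>B \<circ> A\<close> of \<open>A \<in> HTop X Y\<close> and \<open>B \<in> HTop Y Z\<close>; the union is over
  representatives, which all yield the same class.
\<close>

definition hcomp ::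
    "'a pspace \<Rightarrow> 'c pspace \<Rightarrow> ('b \<Rightarrow> 'c) set \<Rightarrow> ('a \<Rightarrow> 'b) set \<Rightarrow> ('a \<Rightarrow> 'c) set" where
  "hcomp X Z B A = (\<Union>f\<in>A. \<Union>g\<in>B. pclass X Z (g \<circ> f))"

definition pointed_homotopy_equivalent :: "'a pspace \<Rightarrow> 'b pspace \<Rightarrow> bool" where
  "pointed_homotopy_equivalent X Y \<longleftrightarrow>
     (\<exists>f g. pmap X Y f \<and> pmap Y X g \<and> phomotopic X X (g \<circ> f) id \<and> phomotopic Y Y (f \<circ> g) id)"


section \<open>Polyhedra\<close>

definition simplicial_complex :: "'v set set \<Rightarrow> bool" where
  "simplicial_complex K \<longleftrightarrow>
     (\<forall>s\<in>K. finite s \<and> s \<noteq> {}) \<and> (\<forall>s\<in>K. \<forall>t. t \<subseteq> s \<and> t \<noteq> {} \<longrightarrow> t \<in> K)"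

text \<open>The closed geometric simplex spanned by \<open>s\<close>, in barycentric coordinates.\<close>

definition geom_simplex :: "'v set \<Rightarrow> ('v \<Rightarrow> real) set" where
  "geom_simplex s = {x. (\<forall>v. 0 \<le> x v) \<and> (\<forall>v. v \<notin> s \<longrightarrow> x v = 0) \<and> (\<Sum>v\<in>s. x v) = 1}"

text \<open>The geometric realization with the weak topology.\<close>

definition polyhedron :: "'v set set \<Rightarrow> ('v \<Rightarrow> real) topology" where
  "polyhedron K = topology (\<lambda>U. U \<subseteq> (\<Union>s\<in>K. geom_simplex s) \<and>
     (\<forall>s\<in>K. openin (subtopology (powertop_real UNIV) (geom_simplex s)) (U \<inter> geom_simplex s)))"

lemma openin_polyhedron:
  "openin (polyhedron K) U \<longleftrightarrow> U \<subseteq> (\<Union>s\<in>K. geom_simplex s) \<and>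
     (\<forall>s\<in>K. openin (subtopology (powertop_real UNIV) (geom_simplex s)) (U \<inter> geom_simplex s))"
proof -
  let ?T = "\<lambda>s. subtopology (powertop_real UNIV) (geom_simplex s)"
  have "istopology (\<lambda>U. U \<subseteq> (\<Union>s\<in>K. geom_simplex s) \<and>
     (\<forall>s\<in>K. openin (?T s) (U \<inter> geom_simplex s)))"
    unfolding istopology_def
  proof (intro conjI allI impI ballI)
    fix S T s
    assume S: "S \<subseteq> (\<Union>s\<in>K. geom_simplex s) \<and> (\<forall>s\<in>K. openin (?T s) (S \<inter> geom_simplex s))"
      and T: "T \<subseteq> (\<Union>s\<in>K. geom_simplex s) \<and> (\<forall>s\<in>K. openin (?T s) (T \<inter> geom_simplex s))"
    show "S \<inter> T \<subseteq> (\<Union>s\<in>K. geom_simplex s)" using S by blast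
    assume "s \<in> K"
    with S T have "openin (?T s) (S \<inter> geom_simplex s)" "openin (?T s) (T \<inter> geom_simplex s)"
      by blast+
    then have "openin (?T s) ((S \<inter> geom_simplex s) \<inter> (T \<inter> geom_simplex s))"
      by (rule openin_Int)
    then show "openin (?T s) (S \<inter> T \<inter> geom_simplex s)"
      by (metis Int_assoc Int_commute Int_left_absorb)
  next
    fix \<K> s
    assume *: "\<forall>U\<in>\<K>. U \<subseteq> (\<Union>s\<in>K. geom_simplex s) \<and> (\<forall>s\<in>K. openin (?T s) (U \<inter> geom_simplex s))"
    show "\<Union>\<K> \<subseteq> (\<Union>s\<in>K. geom_simplex s)" using * by blast
    assume "s \<in> K"
    then have "openin (?T s) (\<Union>U\<in>\<K>. U \<inter> geom_simplex s)"
      using * by (intro openin_Union) auto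
    then show "openin (?T s) (\<Union>\<K> \<inter> geom_simplex s)"
      by (simp only: Int_Union2)
  qed
  then show ?thesis
    unfolding polyhedron_def by (simp only: topology_inverse')
qed

text \<open>
  The type \<open>'v\<close> supplies the vertices of the polyhedra and so plays the role of a universe; HOL
  cannot quantify over all types inside a definition.
\<close>

definition HPol :: "'v itself \<Rightarrow> 'a pspace \<Rightarrow> bool" where
  "HPol (_ :: 'v itself) X \<longleftrightarrow> pointed_space X \<and>
     (\<exists>(K :: 'v set set) v. simplicial_complex K \<and> pointed_space (polyhedron K, v) \<and>
        pointed_homotopy_equivalent X (polyhedron K, v))"


section \<open>Inverse systems and expansions\<close>

text \<open>\<open>bond E l m\<close> is the bonding morphism from \<open>obj E m\<close> to \<open>obj E l\<close> for \<open>l \<le> m\<close>.\<close>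

record ('i, 'b) inv_sys =
  index :: "'i set"
  ile :: "'i \<Rightarrow> 'i \<Rightarrow> bool"
  obj :: "'i \<Rightarrow> 'b pspace"
  bond :: "'i \<Rightarrow> 'i \<Rightarrow> ('b \<Rightarrow> 'b) set"

definition directed_set :: "'i set \<Rightarrow> ('i \<Rightarrow> 'i \<Rightarrow> bool) \<Rightarrow> bool" where
  "directed_set I r \<longleftrightarrow> I \<noteq> {} \<and> (\<forall>l\<in>I. r l l) \<and>
     (\<forall>l\<in>I. \<forall>m\<in>I. \<forall>n\<in>I. r l m \<and> r m n \<longrightarrow> r l n) \<and>
     (\<forall>l\<in>I. \<forall>m\<in>I. \<exists>n\<in>I. r l n \<and> r m n)"

definition HPol_system :: "'v itself \<Rightarrow> ('i, 'b) inv_sys \<Rightarrow> bool" where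
  "HPol_system V E \<longleftrightarrow> directed_set (index E) (ile E) \<and>
     (\<forall>l\<in>index E. HPol V (obj E l)) \<and>
     (\<forall>l\<in>index E. \<forall>m\<in>index E. ile E l m \<longrightarrow> bond E l m \<in> HTop (obj E m) (obj E l)) \<and>
     (\<forall>l\<in>index E. bond E l l = pclass (obj E l) (obj E l) id) \<and>
     (\<forall>l\<in>index E. \<forall>m\<in>index E. \<forall>n\<in>index E. ile E l m \<and> ile E m n \<longrightarrow>
        hcomp (obj E n) (obj E l) (bond E l m) (bond E m n) = bond E l n)"

text \<open>
  The test spaces \<open>P\<close> live on the type of realizations of complexes with vertices in \<open>'v\<close>. For
  \<open>'v\<close> of at least the cardinality of the continuum and of the spaces involved, this is no
  restriction, since maps and homotopies into a polyhedron factor through subcomplexes on that many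
  vertices. For a smaller \<open>'v\<close> fewer test spaces are considered.
\<close>

definition HPol_expansion ::
    "'v itself \<Rightarrow> 'a pspace \<Rightarrow> ('i, 'b) inv_sys \<Rightarrow> ('i \<Rightarrow> ('a \<Rightarrow> 'b) set) \<Rightarrow> bool" where
  "HPol_expansion (V :: 'v itself) X E p \<longleftrightarrow>
     HPol_system V E \<and>
     (\<forall>l\<in>index E. p l \<in> HTop X (obj E l)) \<and>
     (\<forall>l\<in>index E. \<forall>m\<in>index E. ile E l m \<longrightarrow> hcomp X (obj E l) (bond E l m) (p m) = p l) \<and>
     (\<forall>P :: ('v \<Rightarrow> real) pspace. HPol V P \<longrightarrow>
        (\<forall>h\<in>HTop X P. \<exists>l\<in>index E. \<exists>f\<in>HTop (obj E l) P. hcomp X P f (p l) = h)) \<and>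
     (\<forall>P :: ('v \<Rightarrow> real) pspace. HPol V P \<longrightarrow>
        (\<forall>l\<in>index E. \<forall>f0\<in>HTop (obj E l) P. \<forall>f1\<in>HTop (obj E l) P.
           hcomp X P f0 (p l) = hcomp X P f1 (p l) \<longrightarrow>
           (\<exists>m\<in>index E. ile E l m \<and>
              hcomp (obj E m) P f0 (bond E l m) = hcomp (obj E m) P f1 (bond E l m))))"


section \<open>Homotopy groups\<close>

definition sphere_base :: "nat \<Rightarrow> real" where
  "sphere_base = (\<lambda>i. if i = 0 then 1 else 0)"

definition psphere :: "nat \<Rightarrow> (nat \<Rightarrow> real) pspace" where
  "psphere k = (nsphere k, sphere_base)"

definition unit_cube :: "nat \<Rightarrow> (nat \<Rightarrow> real) set" where
  "unit_cube k = {y. (\<forall>i<k. 0 \<le> y i \<and> y i \<le> 1) \<and> (\<forall>i\<ge>k. y i = 0)}"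

text \<open>
  The identification of the cube modulo its boundary with the sphere. With \<open>c = 1 - 2y\<close>, and \<open>d\<close> the
  product of the \<open>1 - c\<^sub>i\<^sup>2\<close> (positive in the interior, zero on the boundary), the map \<open>y \<mapsto> c / d\<close> is a
  homeomorphism from the interior onto Euclidean space, which is followed by inverse stereographic
  projection from the base point. Clearing denominators gives a formula that also covers the boundary,
  all of which goes to the base point.
\<close>

definition cube_to_sphere :: "nat \<Rightarrow> (nat \<Rightarrow> real) \<Rightarrow> (nat \<Rightarrow> real)" where
  "cube_to_sphere k y =
     (let c = (\<lambda>i. 1 - 2 * y i); r = (\<Sum>i<k. (c i)\<^sup>2); d = (\<Prod>i<k. 1 - (c i)\<^sup>2)
      in (\<lambda>i. if i = 0 then (r - d\<^sup>2) / (r + d\<^sup>2)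
              else if i \<le> k then 2 * d * c (i - 1) / (r + d\<^sup>2)
              else 0))"

text \<open>
  Concatenation along the first cube coordinate, transported to the sphere. The choice of the
  preimage \<open>y\<close> is immaterial: it is unique except over the base point, where every choice gives the
  base point of the target.
\<close>

definition sphere_concat ::
    "nat \<Rightarrow> ((nat \<Rightarrow> real) \<Rightarrow> 'b) \<Rightarrow> ((nat \<Rightarrow> real) \<Rightarrow> 'b) \<Rightarrow> (nat \<Rightarrow> real) \<Rightarrow> 'b" where
  "sphere_concat k f g s =
     (let y = inv_into (unit_cube k) (cube_to_sphere k) s
      in if y 0 \<le> 1/2 then f (cube_to_sphere k (y(0 := 2 * y 0)))
         else g (cube_to_sphere k (y(0 := 2 * y 0 - 1))))"

definition homotopy_group :: "nat \<Rightarrow> 'b pspace \<Rightarrow> ((nat \<Rightarrow> real) \<Rightarrow> 'b) set monoid" where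
  "homotopy_group k Y =
     \<lparr>carrier = HTop (psphere k) Y,
      monoid.mult = (\<lambda>A B. \<Union>f\<in>A. \<Union>g\<in>B. pclass (psphere k) Y (sphere_concat k f g)),
      one = pclass (psphere k) Y (\<lambda>_. snd Y)\<rparr>"


section \<open>Shape groups\<close>

text \<open>
  Shape morphisms from the \<open>k\<close>-sphere, as compatible families with respect to the expansion \<open>E\<close>;
  the composite of \<open>F\<close> with the projection to \<open>obj E l\<close> is \<open>F l\<close>.
\<close>

definition shape_mor :: "nat \<Rightarrow> ('i, 'b) inv_sys \<Rightarrow> ('i \<Rightarrow> ((nat \<Rightarrow> real) \<Rightarrow> 'b) set) set" where
  "shape_mor k E = {F \<in> (\<Pi>\<^sub>E l\<in>index E. HTop (psphere k) (obj E l)).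
     \<forall>l\<in>index E. \<forall>m\<in>index E. ile E l m \<longrightarrow> hcomp (psphere k) (obj E l) (bond E l m) (F m) = F l}"

definition shape_group ::
    "nat \<Rightarrow> ('i, 'b) inv_sys \<Rightarrow> ('i \<Rightarrow> ((nat \<Rightarrow> real) \<Rightarrow> 'b) set) monoid" where
  "shape_group k E =
     \<lparr>carrier = shape_mor k E,
      monoid.mult = (\<lambda>F G. \<lambda>l\<in>index E. F l \<otimes>\<^bsub>homotopy_group k (obj E l)\<^esub> G l),
      one = (\<lambda>l\<in>index E. \<one>\<^bsub>homotopy_group k (obj E l)\<^esub>)\<rparr>"

definition shape_nbhd ::
    "nat \<Rightarrow> ('i, 'b) inv_sys \<Rightarrow> 'i \<Rightarrow> ('i \<Rightarrow> ((nat \<Rightarrow> real) \<Rightarrow> 'b) set)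
      \<Rightarrow> ('i \<Rightarrow> ((nat \<Rightarrow> real) \<Rightarrow> 'b) set) set" where
  "shape_nbhd k E l F = {G \<in> shape_mor k E. F l = G l}"

definition shape_topology ::
    "nat \<Rightarrow> ('i, 'b) inv_sys \<Rightarrow> ('i \<Rightarrow> ((nat \<Rightarrow> real) \<Rightarrow> 'b) set) topology" where
  "shape_topology k E = topology (arbitrary union_of
     (\<lambda>U. \<exists>F\<in>shape_mor k E. \<exists>l\<in>index E. U = shape_nbhd k E l F))"

definition topological_group :: "('g, 'm) monoid_scheme \<Rightarrow> 'g topology \<Rightarrow> bool" where
  "topological_group G T \<longleftrightarrow> group G \<and> topspace T = carrier G \<and>
     continuous_map (prod_topology T T) T (\<lambda>(a, b). a \<otimes>\<^bsub>G\<^esub> b) \<and>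
     continuous_map T T (\<lambda>a. inv\<^bsub>G\<^esub> a)"

end

theory Submission
  imports Defs
begin

text \<open>
  Every bonding map \<open>X\<^sub>m \<rightarrow> X\<^sub>l\<close> induces a homomorphism of homotopy groups, so the shape group is an
  inverse limit of groups, with pointwise operations. A basic neighbourhood of \<open>F\<close> consists of the
  \<open>G\<close> with \<open>G l = F l\<close>; as product and inverse are computed coordinatewise, they preserve agreement
  at \<open>l\<close>, which is continuity.

  The substance lies in the group laws for \<open>\<pi>\<^sub>k\<close> with this model of the sphere. The map from the cube
  to the sphere is a quotient map, also after multiplication with an interval, because it is a
  continuous surjection between compact Hausdorff spaces. Hence homotopies on the cube that are
  constant on its boundary descend to pointed homotopies on the sphere, and the group laws follow from
  homotopies that only reparametrize the first cube coordinate.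
\<close>

section \<open>The sphere as a quotient of the cube\<close>

text \<open>If every \<open>1 - 2 * y i\<close> vanishes, the product is 1; otherwise the sum of
  squares is already positive. This covers points outside the cube too, so the formula can be used
  on the whole space.\<close>

lemma cube_to_sphere_denominator_pos:
  "0 < (\<Sum>i<k. (1 - 2 * y i)\<^sup>2) + (\<Prod>i<k. 1 - (1 - 2 * y i)\<^sup>2)\<^sup>2" for y :: "nat \<Rightarrow> real"
proof (cases "\<exists>i<k. 1 - 2 * y i \<noteq> 0")
  case True
  then have "0 < (\<Sum>i<k. (1 - 2 * y i)\<^sup>2)"
    by (metis finite_lessThan lessThan_iff sum_pos2 zero_le_power2 zero_less_power2)
  then show ?thesis by (simp add: add_pos_nonneg)
next
  case False
  then show ?thesis by simp
qed

text \<open>Passes from the abstract product topology to the type class one, so that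
  \<open>continuous_on\<close> and its introduction rules become available.\<close>

lemma nsphere_eq_top_of_set:
  "nsphere k = top_of_set {x. (\<Sum>i\<le>k. (x i)\<^sup>2) = 1 \<and> (\<forall>i>k. x i = 0)}"
  by (simp add: nsphere euclidean_product_topology)

lemma topspace_nsphere_iff:
  "x \<in> topspace (nsphere k) \<longleftrightarrow> (\<Sum>i\<le>k. (x i)\<^sup>2) = 1 \<and> (\<forall>i>k. x i = 0)"
  by (simp add: nsphere_eq_top_of_set)

text \<open>With the common denominator cleared, this is the identity
  \<open>(r - d^2)^2 + 4 * d^2 * r = (r + d^2)^2\<close>.\<close>

lemma cube_to_sphere_in_nsphere: "cube_to_sphere k y \<in> topspace (nsphere k)"
proof -
  define r where "r = (\<Sum>i<k. (1 - 2 * y i)\<^sup>2)"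
  define d where "d = (\<Prod>i<k. 1 - (1 - 2 * y i)\<^sup>2)"
  have pos: "r + d\<^sup>2 > 0"
    unfolding r_def d_def by (rule cube_to_sphere_denominator_pos)
  have "(\<Sum>i\<le>k. (cube_to_sphere k y i)\<^sup>2)
      = ((r - d\<^sup>2) / (r + d\<^sup>2))\<^sup>2 + (\<Sum>i<k. (2 * d * (1 - 2 * y i) / (r + d\<^sup>2))\<^sup>2)"
    by (simp add: sum.atMost_shift cube_to_sphere_def Let_def r_def d_def)
  also have "(\<Sum>i<k. (2 * d * (1 - 2 * y i) / (r + d\<^sup>2))\<^sup>2) = 4 * d\<^sup>2 * r / (r + d\<^sup>2)\<^sup>2"
    by (simp add: r_def power_divide power_mult_distrib sum_distrib_left sum_divide_distrib)
  also have "((r - d\<^sup>2) / (r + d\<^sup>2))\<^sup>2 + 4 * d\<^sup>2 * r / (r + d\<^sup>2)\<^sup>2 = 1"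
  proof -
    have "(r - d\<^sup>2)\<^sup>2 + 4 * d\<^sup>2 * r = (r + d\<^sup>2)\<^sup>2"
      by (simp add: power2_eq_square algebra_simps)
    then show ?thesis
      using pos by (simp add: power_divide flip: add_divide_distrib)
  qed
  finally show ?thesis
    by (simp add: topspace_nsphere_iff cube_to_sphere_def Let_def)
qed

lemma continuous_on_cube_to_sphere: "continuous_on UNIV (cube_to_sphere k)"
proof (rule continuous_on_coordinatewise_then_product)
  fix i
  have [simp]: "(\<Sum>i<k. (1 - 2 * y i)\<^sup>2) + (\<Prod>i<k. 1 - (1 - 2 * y i)\<^sup>2)\<^sup>2 \<noteq> 0"
    for y :: "nat \<Rightarrow> real"
    using cube_to_sphere_denominator_pos[of y k] by linarith
  consider "i = 0" | "i \<noteq> 0" "i \<le> k" | "i > k" by linarith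
  then show "continuous_on UNIV (\<lambda>y. cube_to_sphere k y i)"
  proof cases
    case 1
    then show ?thesis
      unfolding cube_to_sphere_def Let_def by simp (intro continuous_intros; simp)
  next
    case 2
    then show ?thesis
      unfolding cube_to_sphere_def Let_def by simp (intro continuous_intros; simp)
  next
    case 3
    then show ?thesis
      unfolding cube_to_sphere_def Let_def by simp
  qed
qed

section \<open>The fibres of the map: boundary over the base point, injectivity inside\<close>

definition cube_boundary :: "nat \<Rightarrow> (nat \<Rightarrow> real) set" where
  "cube_boundary k = {y \<in> unit_cube k. \<exists>i<k. y i = 0 \<or> y i = 1}"

lemma one_minus_square_nonneg:
  "\<lbrakk>y \<in> unit_cube k; i < k\<rbrakk> \<Longrightarrow> 0 \<le> 1 - (1 - 2 * y i)\<^sup>2"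
  by (auto simp: unit_cube_def abs_square_le_1 abs_le_iff)

text \<open>One factor of the product vanishes on each face, so \<open>d = 0\<close>; the first
  coordinate becomes \<open>r / r = 1\<close> and the others vanish.\<close>

lemma cube_to_sphere_boundary:
  assumes "y \<in> cube_boundary k"
  shows "cube_to_sphere k y = sphere_base"
proof -
  have d: "(\<Prod>i<k. 1 - (1 - 2 * y i)\<^sup>2) = 0"
  proof (rule prod_zero)
    obtain i where "i < k" "y i = 0 \<or> y i = 1" using assms by (auto simp: cube_boundary_def)
    then show "\<exists>i\<in>{..<k}. 1 - (1 - 2 * y i)\<^sup>2 = 0" by (intro bexI[of _ i]) auto
  qed simp
  show ?thesis
    using cube_to_sphere_denominator_pos[where y=y and k=k]
    by (auto simp: cube_to_sphere_def sphere_base_def Let_def d)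
qed

text \<open>Each factor equals \<open>4 * (y i * (1 - y i))\<close>.\<close>

lemma prod_interior_pos:
  assumes "y \<in> unit_cube k" "y \<notin> cube_boundary k"
  shows "0 < (\<Prod>i<k. 1 - (1 - 2 * y i)\<^sup>2)"
proof (rule prod_pos, simp)
  fix i assume "i < k"
  then have "0 < y i" "y i < 1"
    using assms by (auto simp: unit_cube_def cube_boundary_def less_le)
  then have "0 < 4 * (y i * (1 - y i))" by simp
  also have "\<dots> = 1 - (1 - 2 * y i)\<^sup>2" by (simp add: power2_eq_square algebra_simps)
  finally show "(1 - 2 * y i)\<^sup>2 < 1" by simp
qed

text \<open>First coordinate 1 would force \<open>d = 0\<close>, which happens in the cube only on
  the boundary.\<close>

lemma cube_to_sphere_interior_neq_base:
  assumes "y \<in> unit_cube k" "y \<notin> cube_boundary k"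
  shows "cube_to_sphere k y \<noteq> sphere_base"
proof
  define r where "r = (\<Sum>i<k. (1 - 2 * y i)\<^sup>2)"
  define d where "d = (\<Prod>i<k. 1 - (1 - 2 * y i)\<^sup>2)"
  have pos: "r + d\<^sup>2 > 0"
    unfolding r_def d_def by (rule cube_to_sphere_denominator_pos)
  assume "cube_to_sphere k y = sphere_base"
  then have "cube_to_sphere k y 0 = 1" by (simp add: sphere_base_def)
  then have "(r - d\<^sup>2) / (r + d\<^sup>2) = 1"
    by (simp add: cube_to_sphere_def Let_def r_def d_def)
  then have "d = 0" using pos by (simp add: divide_eq_eq)
  then show False using prod_interior_pos[OF assms, folded d_def] by simp
qed

text \<open>Off the base point the stereographic coordinates recover \<open>c / d\<close>; two points of the open
  cube with the same \<open>c / d\<close> lie on one ray from the centre, and \<open>d\<close> decreases along rays.\<close>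

lemma cube_to_sphere_inj_interior:
  assumes y: "y \<in> unit_cube k" "y \<notin> cube_boundary k"
    and z: "z \<in> unit_cube k" "z \<notin> cube_boundary k"
    and eq: "cube_to_sphere k y = cube_to_sphere k z"
  shows "y = z"
proof -
  define r where "r = (\<lambda>y::nat \<Rightarrow> real. \<Sum>i<k. (1 - 2 * y i)\<^sup>2)"
  define d where "d = (\<lambda>y::nat \<Rightarrow> real. \<Prod>i<k. 1 - (1 - 2 * y i)\<^sup>2)"
  have pos: "r y + (d y)\<^sup>2 > 0" for y
    unfolding r_def d_def by (rule cube_to_sphere_denominator_pos)
  have dpos: "0 < d y" "0 < d z"
    unfolding d_def using prod_interior_pos y z by blast+
  \<comment> \<open>Stereographic projection from the base point undoes the formula; cube coordinate
    \<open>i\<close> sits in sphere coordinate \<open>Suc i\<close>.\<close>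
  have stereo: "cube_to_sphere k w (Suc i) / (1 - cube_to_sphere k w 0) = (1 - 2 * w i) / d w"
    if "0 < d w" "i < k" for w i
  proof -
    have "1 - cube_to_sphere k w 0 = 2 * (d w)\<^sup>2 / (r w + (d w)\<^sup>2)"
      using pos[of w] by (simp add: cube_to_sphere_def Let_def r_def d_def field_simps)
    moreover have "cube_to_sphere k w (Suc i) = 2 * d w * (1 - 2 * w i) / (r w + (d w)\<^sup>2)"
      using that(2) by (simp add: cube_to_sphere_def Let_def r_def d_def)
    moreover have "(2 * D * c / N) / (2 * D\<^sup>2 / N) = c / D" if "0 < D" "0 < N" for D c N :: real
      using that by (simp add: power2_eq_square)
    ultimately show ?thesis
      using pos[of w] that(1) by simp
  qed
  have ratio: "(1 - 2 * y i) / d y = (1 - 2 * z i) / d z" if "i < k" for i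
    using stereo[of y i] stereo[of z i] dpos that eq by simp
  \<comment> \<open>Stated for generic \<open>v\<close> and \<open>w\<close> so that it serves both
    orders. If \<open>d w \<le> d v\<close>, equal ratios make each \<open>1 - 2 * w i\<close> at
    most as large in absolute value as \<open>1 - 2 * v i\<close>, so every factor of
    \<open>d w\<close> is at least that of \<open>d v\<close>.\<close>
  have mono: "d v \<le> d w"
    if le: "d w \<le> d v" and w: "0 < d w" and v: "v \<in> unit_cube k"
      and rt: "\<And>i. i < k \<Longrightarrow> (1 - 2 * v i) / d v = (1 - 2 * w i) / d w" for v w
    unfolding d_def
  proof (rule prod_mono, intro conjI)
    fix i assume "i \<in> {..<k}"
    then have i: "i < k" by simp
    show "0 \<le> 1 - (1 - 2 * v i)\<^sup>2" using one_minus_square_nonneg v i by blast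
    have "1 - 2 * w i = (1 - 2 * v i) * (d w / d v)"
      using rt[OF i] w le by (simp add: field_simps)
    then have "\<bar>1 - 2 * w i\<bar> = \<bar>1 - 2 * v i\<bar> * (d w / d v)"
      using w le by (simp add: abs_mult)
    also have "\<dots> \<le> \<bar>1 - 2 * v i\<bar>"
      using w le by (intro mult_left_le) auto
    finally show "1 - (1 - 2 * v i)\<^sup>2 \<le> 1 - (1 - 2 * w i)\<^sup>2"
      by (simp add: abs_le_square_iff)
  qed
  have "d y = d z"
    using mono[of z y] mono[of y z] dpos ratio y z by (metis linorder_le_cases order_antisym)
  then have "y i = z i" if "i < k" for i
    using ratio[OF that] dpos by simp
  moreover have "y i = z i" if "\<not> i < k" for i
    using y z that by (simp add: unit_cube_def)
  ultimately show ?thesis by blast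
qed

section \<open>Surjectivity onto the sphere\<close>

lemma sphere_base_if_first_eq_1:
  assumes "x \<in> topspace (nsphere k)" "x 0 = 1"
  shows "x = sphere_base"
proof
  fix i
  have "(\<Sum>i<k. (x (Suc i))\<^sup>2) = 0"
    using assms by (simp add: topspace_nsphere_iff sum.atMost_shift)
  then have "x (Suc j) = 0" if "j < k" for j
    using that by (simp add: sum_nonneg_eq_0_iff)
  moreover have "x i = 0" if "i > k"
    using assms that by (simp add: topspace_nsphere_iff)
  ultimately show "x i = sphere_base i"
    using assms(2) by (cases i) (auto simp: sphere_base_def, metis not_less_eq)
qed

text \<open>The preimage on the ray through \<open>v\<close>, the stereographic image of the given point, is found by
  the intermediate value theorem for \<open>t = d\<close>.\<close>

lemma cube_to_sphere_surj:
  assumes k: "0 < k" and x: "x \<in> topspace (nsphere k)"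
  shows "\<exists>y\<in>unit_cube k. cube_to_sphere k y = x"
proof (cases "x 0 = 1")
  case True
  \<comment> \<open>The base point is hit by any boundary point; the origin is one because
    \<open>k\<close> is positive.\<close>
  have "(\<lambda>_. 0) \<in> cube_boundary k" using k by (auto simp: cube_boundary_def unit_cube_def)
  then show ?thesis
    using sphere_base_if_first_eq_1[OF x True] cube_to_sphere_boundary
    by (metis (no_types, lifting) cube_boundary_def mem_Collect_eq)
next
  case False
  have sphere: "(x 0)\<^sup>2 + (\<Sum>i<k. (x (Suc i))\<^sup>2) = 1"
    using x by (simp add: topspace_nsphere_iff sum.atMost_shift)
  moreover have "(\<Sum>i<k. (x (Suc i))\<^sup>2) \<ge> 0" by (simp add: sum_nonneg)
  ultimately have "(x 0)\<^sup>2 \<le> 1" by linarith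
  then have x0: "x 0 < 1" using False by (simp add: abs_square_le_1)
  define v where "v = (\<lambda>i. x (Suc i) / (1 - x 0))"
  define n where "n = (\<Sum>i<k. (v i)\<^sup>2)"
  have "n = (1 - (x 0)\<^sup>2) / (1 - x 0)\<^sup>2"
    using sphere by (simp add: n_def v_def power_divide flip: sum_divide_distrib)
  also have "1 - (x 0)\<^sup>2 = (1 + x 0) * (1 - x 0)"
    by (simp add: power2_eq_square algebra_simps)
  finally have n: "n = (1 + x 0) / (1 - x 0)"
    using x0 by (simp add: power2_eq_square)
  \<comment> \<open>A zero of \<open>h\<close> is a \<open>t\<close> equal to the value of
    \<open>d\<close> at the point with \<open>c = t * v\<close>. The truncation by
    \<open>max 0\<close> keeps the factors in \<open>{0..1}\<close>, whence
    \<open>h 1 \<ge> 0\<close>; \<open>small\<close> shows later that it is inactive at the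
    zero.\<close>
  define h where "h = (\<lambda>t::real. t - (\<Prod>i<k. max 0 (1 - (t * v i)\<^sup>2)))"
  have "\<exists>t\<ge>0. t \<le> 1 \<and> h t = 0"
  proof (rule IVT')
    show "h 0 \<le> 0" by (simp add: h_def)
    have "(\<Prod>i<k. max 0 (1 - (1 * v i)\<^sup>2)) \<le> 1" by (rule prod_le_1) auto
    then show "0 \<le> h 1" by (simp add: h_def)
    show "continuous_on {0..1} h" unfolding h_def by (intro continuous_intros)
  qed auto
  then obtain t where t: "0 \<le> t" "t = (\<Prod>i<k. max 0 (1 - (t * v i)\<^sup>2))" by (auto simp: h_def)
  have t0: "t > 0"
  proof (rule ccontr)
    assume "\<not> ?thesis"
    then have "t = 0" using t by simp
    then show False using t(2) by simp
  qed
  have small: "(t * v i)\<^sup>2 < 1" if "i < k" for i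
  proof (rule ccontr)
    assume "\<not> ?thesis"
    then have "(\<Prod>i<k. max 0 (1 - (t * v i)\<^sup>2)) = 0"
      using that by (intro prod_zero) (auto intro!: bexI[of _ i])
    then show False using t t0 by simp
  qed
  \<comment> \<open>Solves \<open>1 - 2 * y i = t * v i\<close>; since \<open>d\<close> equals
    \<open>t\<close> here, \<open>c / d\<close> is \<open>v\<close>.\<close>
  define y where "y = (\<lambda>i. if i < k then (1 - t * v i) / 2 else 0)"
  have c: "1 - 2 * y i = t * v i" if "i < k" for i using that by (simp add: y_def field_simps)
  have "\<bar>t * v i\<bar> < 1" if "i < k" for i
    using small[OF that] by (simp add: abs_square_less_1)
  then have "y \<in> unit_cube k"
    by (fastforce simp: unit_cube_def y_def abs_less_iff)
  moreover have "cube_to_sphere k y = x"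
  proof
    fix i
    have d: "(\<Prod>i<k. 1 - (1 - 2 * y i)\<^sup>2) = t"
    proof -
      have "(\<Prod>i<k. 1 - (1 - 2 * y i)\<^sup>2) = (\<Prod>i<k. max 0 (1 - (t * v i)\<^sup>2))"
        using small by (intro prod.cong) (auto simp: c max_def not_less less_imp_le)
      then show ?thesis using t by simp
    qed
    have r: "(\<Sum>i<k. (1 - 2 * y i)\<^sup>2) = t\<^sup>2 * n"
      by (simp add: c n_def power_mult_distrib sum_distrib_left)
    have n1: "n + 1 = 2 / (1 - x 0)" using x0 n by (simp add: field_simps)
    have n2: "n - 1 = 2 * x 0 / (1 - x 0)" using x0 n by (simp add: field_simps)
    consider "i = 0" | j where "i = Suc j" "j < k" | "i > k"
      by (metis Suc_less_eq2 less_Suc_eq_0_disj linorder_neqE_nat not_less_eq)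
    then show "cube_to_sphere k y i = x i"
    proof cases
      case 1
      have "cube_to_sphere k y 0 = (t\<^sup>2 * n - t\<^sup>2) / (t\<^sup>2 * n + t\<^sup>2)"
        by (simp add: cube_to_sphere_def Let_def r d)
      also have "\<dots> = (t\<^sup>2 * (n - 1)) / (t\<^sup>2 * (n + 1))" by (simp add: algebra_simps)
      also have "\<dots> = x 0" using t0 x0 by (simp only: n1 n2) simp
      finally show ?thesis using 1 by simp
    next
      case 2
      have "cube_to_sphere k y i = 2 * t * (t * v j) / (t\<^sup>2 * n + t\<^sup>2)"
        using 2 c[OF 2(2)] by (simp add: cube_to_sphere_def Let_def r d)
      also have "\<dots> = (t\<^sup>2 * (2 * v j)) / (t\<^sup>2 * (n + 1))"
        by (simp add: algebra_simps power2_eq_square)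
      also have "\<dots> = x i" using t0 x0 2 by (simp only: n1) (simp add: v_def)
      finally show ?thesis .
    next
      case 3
      then show ?thesis using x by (simp add: cube_to_sphere_def Let_def topspace_nsphere_iff)
    qed
  qed
  ultimately show ?thesis by blast
qed

lemma cube_to_sphere_image:
  "0 < k \<Longrightarrow> cube_to_sphere k ` unit_cube k = topspace (nsphere k)"
  using cube_to_sphere_surj[of k] cube_to_sphere_in_nsphere[of k] by blast

section \<open>The quotient map on the cylinder\<close>

text \<open>A product of compact sets, with singletons \<open>{0}\<close> in the coordinates from
  \<open>k\<close> on.\<close>

lemma compact_unit_cube: "compact (unit_cube k)"
proof -
  have "unit_cube k = PiE UNIV (\<lambda>i. if i < k then {0..1} else {0})"
    by (auto simp: unit_cube_def PiE_UNIV_domain Pi_iff split: if_splits)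
  then have "compactin (powertop_real UNIV) (unit_cube k)"
    by (simp add: compactin_PiE)
  then show ?thesis by (simp add: euclidean_product_topology)
qed

text \<open>The interval factor is included because homotopies, not only maps, must descend. For
  \<open>k = 0\<close> surjectivity would fail: the cube is then a point and the sphere has
  two.\<close>

lemma quotient_map_cylinder_cube_to_sphere:
  assumes "0 < k"
  shows "quotient_map (top_of_set ({0..1::real} \<times> unit_cube k))
           (prod_topology (top_of_set {0..1}) (nsphere k)) (\<lambda>(t, y). (t, cube_to_sphere k y))"
proof (rule continuous_closed_imp_quotient_map)
  let ?Q = "\<lambda>(t::real, y). (t, cube_to_sphere k y)"
  have "continuous_on ({0..1} \<times> unit_cube k) ?Q"
    unfolding case_prod_unfold
    by (intro continuous_intros continuous_on_compose2[OF continuous_on_cube_to_sphere]) auto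
  then show cont: "continuous_map (top_of_set ({0..1} \<times> unit_cube k))
      (prod_topology (top_of_set {0..1}) (nsphere k)) ?Q"
    using cube_to_sphere_in_nsphere
    by (auto simp: nsphere_eq_top_of_set continuous_map_in_subtopology)
  show "closed_map (top_of_set ({0..1} \<times> unit_cube k))
      (prod_topology (top_of_set {0..1}) (nsphere k)) ?Q"
  proof (rule continuous_imp_closed_map_gen[OF _ _ cont])
    show "compact_space (top_of_set ({0..1::real} \<times> unit_cube k))"
      by (simp add: compact_space_subtopology compact_Times compact_unit_cube)
    show "kc_space (prod_topology (top_of_set {0..1::real}) (nsphere k))"
      by (intro Hausdorff_imp_kc_space)
        (auto simp: Hausdorff_space_prod_topology Hausdorff_space_subtopology nsphere_def Hausdorff_Euclidean_space)
  qed
  show "?Q ` topspace (top_of_set ({0..1} \<times> unit_cube k))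
      = topspace (prod_topology (top_of_set {0..1}) (nsphere k))"
    using cube_to_sphere_image[OF assms] by (fastforce simp: image_iff)
qed

section \<open>Composition of pointed homotopy classes\<close>

lemma phomotopic_imp_pmap:
  assumes "phomotopic X Y f g"
  shows "pmap X Y f" "pmap X Y g"
  using homotopic_with_imp_continuous_maps[OF assms[unfolded phomotopic_def]]
    homotopic_with_imp_property[OF assms[unfolded phomotopic_def]]
  by (simp_all add: pmap_def)

lemma phomotopic_refl: "pmap X Y f \<Longrightarrow> phomotopic X Y f f"
  by (simp add: phomotopic_def pmap_def)

lemma phomotopic_sym: "phomotopic X Y f g \<Longrightarrow> phomotopic X Y g f"
  unfolding phomotopic_def by (rule homotopic_with_symD)

lemma phomotopic_trans: "\<lbrakk>phomotopic X Y f g; phomotopic X Y g h\<rbrakk> \<Longrightarrow> phomotopic X Y f h"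
  unfolding phomotopic_def by (rule homotopic_with_trans)

text \<open>Classes ignore values outside the space. The base point lies in the space, so
  \<open>g\<close> is pointed as well.\<close>

lemma phomotopic_eqI:
  assumes "pointed_space X" "pmap X Y f" "\<And>x. x \<in> topspace (fst X) \<Longrightarrow> f x = g x"
  shows "phomotopic X Y f g"
  using assms unfolding phomotopic_def pmap_def pointed_space_def
  by (intro homotopic_with_equal) auto

lemma pclass_eqI: "phomotopic X Y f g \<Longrightarrow> pclass X Y f = pclass X Y g"
  unfolding pclass_def using phomotopic_sym phomotopic_trans by blast

lemma pclass_self: "pmap X Y f \<Longrightarrow> f \<in> pclass X Y f"
  by (simp add: pclass_def phomotopic_refl)

lemma HTopE:
  assumes "A \<in> HTop X Y"
  obtains f where "pmap X Y f" "A = pclass X Y f"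
  using assms by (auto simp: HTop_def)

lemma pclass_in_HTop: "pmap X Y f \<Longrightarrow> pclass X Y f \<in> HTop X Y"
  by (simp add: HTop_def)

lemma pmap_compose: "\<lbrakk>pmap X Y f; pmap Y Z g\<rbrakk> \<Longrightarrow> pmap X Z (g \<circ> f)"
  by (auto simp: pmap_def intro: continuous_map_compose)

lemma phomotopic_compose:
  assumes f: "phomotopic X Y f f'" and g: "phomotopic Y Z g g'"
  shows "phomotopic X Z (g \<circ> f) (g' \<circ> f')"
proof -
  note pm = phomotopic_imp_pmap[OF f] phomotopic_imp_pmap[OF g]
  have "phomotopic X Z (g \<circ> f) (g \<circ> f')"
    unfolding phomotopic_def
    by (rule homotopic_with_compose_continuous_map_left[OF f[unfolded phomotopic_def]])
      (use pm in \<open>auto simp: pmap_def\<close>)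
  moreover have "phomotopic X Z (g \<circ> f') (g' \<circ> f')"
    unfolding phomotopic_def
    by (rule homotopic_with_compose_continuous_map_right[OF g[unfolded phomotopic_def]])
      (use pm in \<open>auto simp: pmap_def\<close>)
  ultimately show ?thesis by (rule phomotopic_trans)
qed

text \<open>The union defining \<open>hcomp\<close> runs over nonempty sets of representatives, and
  all of them contribute the same class.\<close>

lemma hcomp_pclass:
  assumes f: "pmap X Y f" and g: "pmap Y Z g"
  shows "hcomp X Z (pclass Y Z g) (pclass X Y f) = pclass X Z (g \<circ> f)"
proof -
  have "pclass X Z (g' \<circ> f') = pclass X Z (g \<circ> f)"
    if "f' \<in> pclass X Y f" "g' \<in> pclass Y Z g" for f' g'
    using that phomotopic_compose[of X Y f f' Z g g'] pclass_eqI[of X Z "g \<circ> f" "g' \<circ> f'"]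
    by (simp add: pclass_def)
  then show ?thesis
    unfolding hcomp_def using pclass_self[OF f] pclass_self[OF g] by blast
qed

lemma hcomp_in_HTop:
  assumes "A \<in> HTop X Y" "B \<in> HTop Y Z"
  shows "hcomp X Z B A \<in> HTop X Z"
  using assms by (auto elim!: HTopE simp: hcomp_pclass intro!: pclass_in_HTop pmap_compose)

section \<open>Homotopies descending from the cube\<close>

lemma fst_psphere [simp]: "fst (psphere k) = nsphere k"
  and snd_psphere [simp]: "snd (psphere k) = sphere_base"
  by (simp_all add: psphere_def)

lemma pointed_space_psphere: "pointed_space (psphere k)"
  by (simp add: pointed_space_def topspace_nsphere_iff sphere_base_def sum.atMost_shift)

lemma cube_boundary_subset: "cube_boundary k \<subseteq> unit_cube k"
  by (auto simp: cube_boundary_def)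

lemma unit_cube_update:
  "\<lbrakk>y \<in> unit_cube k; 0 < k; 0 \<le> a; a \<le> 1\<rbrakk> \<Longrightarrow> y(0 := a) \<in> unit_cube k"
  by (auto simp: unit_cube_def)

lemma cube_boundary_update_end:
  "\<lbrakk>y \<in> unit_cube k; 0 < k; a = 0 \<or> a = 1\<rbrakk> \<Longrightarrow> y(0 := a) \<in> cube_boundary k"
  by (auto simp: cube_boundary_def intro: unit_cube_update)

text \<open>A face in another direction is unaffected by the update; on a face of coordinate 0 the
  last assumption keeps the new value at an end.\<close>

lemma cube_boundary_update:
  assumes "y \<in> cube_boundary k" "0 < k" "0 \<le> a" "a \<le> 1"
    and "y 0 = 0 \<or> y 0 = 1 \<Longrightarrow> a = 0 \<or> a = 1"
  shows "y(0 := a) \<in> cube_boundary k"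
proof -
  obtain i where i: "i < k" "y i = 0 \<or> y i = 1" using assms by (auto simp: cube_boundary_def)
  have "(y(0 := a)) i = 0 \<or> (y(0 := a)) i = 1" using i assms(5) by (cases "i = 0") auto
  then show ?thesis
    using i assms unit_cube_update[of y k a] by (auto simp only: cube_boundary_def mem_Collect_eq)
qed

lemma inv_into_cube_to_sphere:
  assumes "0 < k" "s \<in> topspace (nsphere k)"
  shows "inv_into (unit_cube k) (cube_to_sphere k) s \<in> unit_cube k"
    and "cube_to_sphere k (inv_into (unit_cube k) (cube_to_sphere k) s) = s"
  using assms cube_to_sphere_image[of k] by (simp_all add: inv_into_into f_inv_into_f)

text \<open>Makes the chosen preimage harmless: any function constant on the boundary takes the same
  value at \<open>z\<close> and at \<open>y\<close>.\<close>

lemma inv_into_cube_to_sphere_cases: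
  assumes k: "0 < k" and y: "y \<in> unit_cube k"
  defines "z \<equiv> inv_into (unit_cube k) (cube_to_sphere k) (cube_to_sphere k y)"
  obtains "z = y" | "z \<in> cube_boundary k" "y \<in> cube_boundary k"
proof -
  have z: "z \<in> unit_cube k" "cube_to_sphere k z = cube_to_sphere k y"
    unfolding z_def using inv_into_cube_to_sphere[OF k cube_to_sphere_in_nsphere] by auto
  show thesis
    using that z y cube_to_sphere_inj_interior[of z k y] cube_to_sphere_boundary
      cube_to_sphere_interior_neq_base by metis
qed

text \<open>Composed with the quotient map, the descended function is \<open>H\<close> again, so the
  universal property gives continuity.\<close>

lemma continuous_map_cylinder_descend:
  assumes k: "0 < k"
    and cont: "continuous_map (top_of_set ({0..1::real} \<times> unit_cube k)) Y (\<lambda>(t, y). H t y)"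
    and bd: "\<And>t y. \<lbrakk>t \<in> {0..1}; y \<in> cube_boundary k\<rbrakk> \<Longrightarrow> H t y = y0"
  shows "continuous_map (prod_topology (top_of_set {0..1}) (nsphere k)) Y
           (\<lambda>(t, s). H t (inv_into (unit_cube k) (cube_to_sphere k) s))"
proof (rule continuous_compose_quotient_map[OF quotient_map_cylinder_cube_to_sphere[OF k]])
  have "H t (inv_into (unit_cube k) (cube_to_sphere k) (cube_to_sphere k y)) = H t y"
    if "t \<in> {0..1}" "y \<in> unit_cube k" for t y
    using inv_into_cube_to_sphere_cases[OF k that(2)] bd that(1) by metis
  then show "continuous_map (top_of_set ({0..1} \<times> unit_cube k)) Y
     ((\<lambda>(t, s). H t (inv_into (unit_cube k) (cube_to_sphere k) s)) \<circ>
      (\<lambda>(t, y). (t, cube_to_sphere k y)))"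
    by (intro continuous_map_eq[OF cont]) auto
qed

lemma phomotopic_cube:
  assumes k: "0 < k"
    and cont: "continuous_map (top_of_set ({0..1::real} \<times> unit_cube k)) (fst Y) (\<lambda>(t, y). H t y)"
    and bd: "\<And>t y. \<lbrakk>t \<in> {0..1}; y \<in> cube_boundary k\<rbrakk> \<Longrightarrow> H t y = snd Y"
    and f: "\<And>y. y \<in> unit_cube k \<Longrightarrow> f (cube_to_sphere k y) = H 0 y"
    and g: "\<And>y. y \<in> unit_cube k \<Longrightarrow> g (cube_to_sphere k y) = H 1 y"
  shows "phomotopic (psphere k) Y f g"
proof -
  let ?inv = "inv_into (unit_cube k) (cube_to_sphere k)"
  have "(\<lambda>_. 0) \<in> cube_boundary k" using k by (auto simp: cube_boundary_def unit_cube_def)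
  \<comment> \<open>The origin maps to the base point, so the preimage chosen there is also on the
    boundary. This makes every stage of the homotopy pointed.\<close>
  then have base: "?inv sphere_base \<in> cube_boundary k"
    using inv_into_cube_to_sphere_cases[OF k, of "\<lambda>_. 0"] cube_to_sphere_boundary
      cube_boundary_subset by (metis subsetD)
  have "homotopic_with (\<lambda>h. h sphere_base = snd Y) (nsphere k) (fst Y)
          (\<lambda>s. H 0 (?inv s)) (\<lambda>s. H 1 (?inv s))"
    unfolding homotopic_with_def
    by (rule exI[of _ "\<lambda>(t, s). H t (?inv s)"])
      (use continuous_map_cylinder_descend[OF k cont bd] bd base in auto)
  then have *: "phomotopic (psphere k) Y (\<lambda>s. H 0 (?inv s)) (\<lambda>s. H 1 (?inv s))"
    by (simp add: phomotopic_def)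
  have f': "H 0 (?inv s) = f s" and g': "H 1 (?inv s) = g s" if "s \<in> topspace (nsphere k)" for s
    using inv_into_cube_to_sphere[OF k that] f g by metis+
  \<comment> \<open>The ends of the homotopy are known to agree with \<open>f\<close> and
    \<open>g\<close> on the sphere only, so they are replaced up to
    \<open>phomotopic\<close>.\<close>
  have "phomotopic (psphere k) Y (\<lambda>s. H 0 (?inv s)) f"
    and "phomotopic (psphere k) Y (\<lambda>s. H 1 (?inv s)) g"
    using phomotopic_imp_pmap[OF *] f' g'
    by (auto intro!: phomotopic_eqI pointed_space_psphere)
  then show ?thesis
    using * by (meson phomotopic_sym phomotopic_trans)
qed

section \<open>Reparametrizing the first cube coordinate\<close>

lemma continuous_on_update:
  fixes a :: "'a::topological_space \<Rightarrow> real"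
  assumes "continuous_on S a" "continuous_on S f"
  shows "continuous_on S (\<lambda>z. (f z)(i := a z))"
proof (rule continuous_on_coordinatewise_then_product)
  fix j
  show "continuous_on S (\<lambda>z. ((f z)(i := a z)) j)"
    using assms by (cases "j = i") (auto intro: continuous_on_product_then_coordinatewise)
qed

text \<open>Each group law compares two reparametrizations of one and the same map.\<close>

lemma phomotopic_reparametrization:
  fixes a b :: "real \<Rightarrow> real"
  assumes k: "0 < k" and h: "pmap (psphere k) Y h"
    and a: "continuous_on {0..1} a" "a \<in> {0..1} \<rightarrow> {0..1}"
    and b: "continuous_on {0..1} b" "b \<in> {0..1} \<rightarrow> {0..1}"
    and end0: "a 0 = b 0" "a 0 \<in> {0, 1}" and end1: "a 1 = b 1" "a 1 \<in> {0, 1}"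
    and f: "\<And>y. y \<in> unit_cube k \<Longrightarrow> f (cube_to_sphere k y) = h (cube_to_sphere k (y(0 := a (y 0))))"
    and g: "\<And>y. y \<in> unit_cube k \<Longrightarrow> g (cube_to_sphere k y) = h (cube_to_sphere k (y(0 := b (y 0))))"
  shows "phomotopic (psphere k) Y f g"
proof (rule phomotopic_cube[OF k])
  \<comment> \<open>The straight-line homotopy from \<open>a\<close> to \<open>b\<close>, which
    stays in the unit interval by convexity.\<close>
  let ?c = "\<lambda>t x. (1 - t) * a x + t * b x"
  let ?H = "\<lambda>t y. h (cube_to_sphere k (y(0 := ?c t (y 0))))"
  have y0: "y 0 \<in> {0..1}" if "y \<in> unit_cube k" for y using that k by (auto simp: unit_cube_def)
  have c01: "?c t x \<in> {0..1}" if "t \<in> {0..1}" "x \<in> {0..1}" for t x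
  proof -
    have "a x \<in> {0..1}" "b x \<in> {0..1}" using that a b by auto
    then show ?thesis
      using that convex_bound_le[of "a x" 1 "b x" "1 - t" t] by auto
  qed
  have "continuous_on ({0..1} \<times> unit_cube k)
      (\<lambda>z. cube_to_sphere k ((snd z)(0 := ?c (fst z) (snd z 0))))"
    using y0
    by (intro continuous_on_compose2[OF continuous_on_cube_to_sphere] continuous_on_update
        continuous_intros continuous_on_compose2[OF a(1)] continuous_on_compose2[OF b(1)]
        continuous_on_product_then_coordinatewise) auto
  then have "continuous_map (top_of_set ({0..1} \<times> unit_cube k)) (nsphere k)
      (\<lambda>z. cube_to_sphere k ((snd z)(0 := ?c (fst z) (snd z 0))))"
    using cube_to_sphere_in_nsphere
    by (auto simp: nsphere_eq_top_of_set continuous_map_in_subtopology)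
  moreover have "continuous_map (nsphere k) (fst Y) h"
    using h by (simp add: pmap_def)
  ultimately have "continuous_map (top_of_set ({0..1} \<times> unit_cube k)) (fst Y)
      (h \<circ> (\<lambda>z. cube_to_sphere k ((snd z)(0 := ?c (fst z) (snd z 0)))))"
    by (rule continuous_map_compose)
  then show "continuous_map (top_of_set ({0..1} \<times> unit_cube k)) (fst Y) (\<lambda>(t, y). ?H t y)"
    by (simp add: o_def case_prod_unfold)
  show "?H t y = snd Y" if t: "t \<in> {0..1}" and y: "y \<in> cube_boundary k" for t y
  proof -
    have "y \<in> unit_cube k" using y cube_boundary_subset by blast
    \<comment> \<open>Since \<open>a\<close> and \<open>b\<close> agree at 0 and at 1, the
      interpolation is constant in \<open>t\<close> there and its value is an end of the interval;
      so boundary points stay on the boundary.\<close>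
    moreover have "(1 - t) * e + t * e = e" for e :: real by (simp add: algebra_simps)
    ultimately have "y(0 := ?c t (y 0)) \<in> cube_boundary k"
      using end0 end1 c01[OF t y0, of y]
      by (intro cube_boundary_update y k) auto
    then show ?thesis
      using h by (simp add: cube_to_sphere_boundary pmap_def)
  qed
qed (simp_all add: f g)

section \<open>Concatenation read on the cube\<close>

text \<open>Replaces the preimage chosen in \<open>sphere_concat\<close> by the given
  \<open>y\<close>. The right-hand side is constantly \<open>b\<close> on the boundary, so the
  choice does not matter.\<close>

lemma sphere_concat_cube_to_sphere:
  assumes k: "0 < k" and f: "f sphere_base = b" and g: "g sphere_base = b"
    and y: "y \<in> unit_cube k"
  shows "sphere_concat k f g (cube_to_sphere k y) =
    (if y 0 \<le> 1/2 then f (cube_to_sphere k (y(0 := 2 * y 0)))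
     else g (cube_to_sphere k (y(0 := 2 * y 0 - 1))))" (is "_ = ?R y")
proof -
  let ?z = "inv_into (unit_cube k) (cube_to_sphere k) (cube_to_sphere k y)"
  have bd: "?R w = b" if w: "w \<in> cube_boundary k" for w
  proof -
    have "0 \<le> w 0" "w 0 \<le> 1" using w k by (auto simp: cube_boundary_def unit_cube_def)
    then have "w 0 \<le> 1/2 \<Longrightarrow> w(0 := 2 * w 0) \<in> cube_boundary k"
      and "\<not> w 0 \<le> 1/2 \<Longrightarrow> w(0 := 2 * w 0 - 1) \<in> cube_boundary k"
      by (intro cube_boundary_update w k; auto)+
    then show ?thesis
      using f g by (metis cube_to_sphere_boundary)
  qed
  have "sphere_concat k f g (cube_to_sphere k y) = ?R ?z"
    by (simp add: sphere_concat_def Let_def)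
  also have "\<dots> = ?R y"
    using inv_into_cube_to_sphere_cases[OF k y] bd by metis
  finally show ?thesis .
qed

text \<open>Makes multiplication of classes well defined: the two homotopies are pasted along
  \<open>y 0 = 1/2\<close>. The case of constant homotopies also shows that a concatenation is
  continuous.\<close>

lemma phomotopic_sphere_concat:
  assumes k: "0 < k"
    and f: "phomotopic (psphere k) Y f f'" and g: "phomotopic (psphere k) Y g g'"
  shows "phomotopic (psphere k) Y (sphere_concat k f g) (sphere_concat k f' g')"
proof -
  let ?I = "top_of_set {0..1::real}"
  let ?C = "top_of_set ({0..1::real} \<times> unit_cube k)"
  obtain F where F: "continuous_map (prod_topology ?I (nsphere k)) (fst Y) F"
      "\<And>x. F (0, x) = f x" "\<And>x. F (1, x) = f' x" "\<And>t. t \<in> {0..1} \<Longrightarrow> F (t, sphere_base) = snd Y"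
    using f by (auto simp: phomotopic_def homotopic_with_def)
  obtain G where G: "continuous_map (prod_topology ?I (nsphere k)) (fst Y) G"
      "\<And>x. G (0, x) = g x" "\<And>x. G (1, x) = g' x" "\<And>t. t \<in> {0..1} \<Longrightarrow> G (t, sphere_base) = snd Y"
    using g by (auto simp: phomotopic_def homotopic_with_def)
  let ?H = "\<lambda>t y. if y 0 \<le> 1/2 then F (t, cube_to_sphere k (y(0 := 2 * y 0)))
     else G (t, cube_to_sphere k (y(0 := 2 * y 0 - 1)))"
  \<comment> \<open>Handles both halves at once. The rescaling \<open>a\<close> may leave the unit
    interval, because \<open>cube_to_sphere\<close> takes every point to the sphere.\<close>
  have half: "continuous_map (top_of_set (({0..1} \<times> unit_cube k) \<inter> S)) (fst Y)
      (\<lambda>z. K (fst z, cube_to_sphere k ((snd z)(0 := a (snd z 0)))))"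
    if K: "continuous_map (prod_topology ?I (nsphere k)) (fst Y) K"
      and a: "continuous_on UNIV a" for K S and a :: "real \<Rightarrow> real"
  proof -
    let ?S = "({0..1} \<times> unit_cube k) \<inter> S"
    let ?q = "\<lambda>z. (fst z, cube_to_sphere k ((snd z)(0 := a (snd z 0))))"
    have "continuous_on ?S ?q"
      by (intro continuous_on_compose2[OF continuous_on_cube_to_sphere] continuous_on_update
          continuous_intros continuous_on_compose2[OF a]
          continuous_on_product_then_coordinatewise) auto
    then have "continuous_map (top_of_set ?S) (prod_topology ?I (nsphere k)) ?q"
      using cube_to_sphere_in_nsphere
      by (auto simp: nsphere_eq_top_of_set continuous_map_in_subtopology)
    from continuous_map_compose[OF this K] show ?thesis by (simp add: o_def)
  qed
  have "continuous_map ?C (fst Y) (\<lambda>z. if snd z 0 \<le> 1/2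
      then F (fst z, cube_to_sphere k ((snd z)(0 := 2 * snd z 0)))
      else G (fst z, cube_to_sphere k ((snd z)(0 := 2 * snd z 0 - 1))))"
  proof (rule continuous_map_cases_le)
    show "continuous_map ?C euclideanreal (\<lambda>z. snd z 0)"
      unfolding continuous_map_iff_continuous
      by (rule continuous_on_product_then_coordinatewise[OF continuous_on_snd[OF continuous_on_id]])
  next
    \<comment> \<open>At the seam the rescaled coordinates are 1 and 0, so both branches yield the
      base point.\<close>
    fix z assume z: "z \<in> topspace ?C" "snd z 0 = 1/2"
    then have "(snd z)(0 := 2 * snd z 0) \<in> cube_boundary k"
      and "(snd z)(0 := 2 * snd z 0 - 1) \<in> cube_boundary k"
      using k by (auto intro!: cube_boundary_update_end)
    moreover have "fst z \<in> {0..1}" using z by auto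
    ultimately show "F (fst z, cube_to_sphere k ((snd z)(0 := 2 * snd z 0)))
        = G (fst z, cube_to_sphere k ((snd z)(0 := 2 * snd z 0 - 1)))"
      using F(4) G(4) by (simp only: cube_to_sphere_boundary)
  next
    show "continuous_map (subtopology ?C {z \<in> topspace ?C. snd z 0 \<le> 1/2}) (fst Y)
        (\<lambda>z. F (fst z, cube_to_sphere k ((snd z)(0 := 2 * snd z 0))))"
      unfolding subtopology_subtopology by (intro half F continuous_intros)
    show "continuous_map (subtopology ?C {z \<in> topspace ?C. 1/2 \<le> snd z 0}) (fst Y)
        (\<lambda>z. G (fst z, cube_to_sphere k ((snd z)(0 := 2 * snd z 0 - 1))))"
      unfolding subtopology_subtopology by (intro half G continuous_intros)
  qed simp
  then have cont: "continuous_map ?C (fst Y) (\<lambda>(t, y). ?H t y)"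
    by (simp add: case_prod_unfold)
  \<comment> \<open>Each stage is itself a concatenation, hence depends on \<open>y\<close> only
    through its image on the sphere. The end conditions and constancy on the boundary both follow
    from this.\<close>
  have H: "?H t y = sphere_concat k (\<lambda>x. F (t, x)) (\<lambda>x. G (t, x)) (cube_to_sphere k y)"
    if "t \<in> {0..1}" "y \<in> unit_cube k" for t y
    using F(4) G(4) that
    by (subst sphere_concat_cube_to_sphere[where b = "snd Y"]) (simp_all add: k)
  show ?thesis
  proof (rule phomotopic_cube[OF k cont])
    fix t y assume t: "t \<in> {0..1::real}" and y: "y \<in> cube_boundary k"
    \<comment> \<open>The common value on the boundary is computed at the origin, which falls under
      the first branch.\<close>
    have z: "(\<lambda>_. 0) \<in> unit_cube k" "(\<lambda>_. 0) \<in> cube_boundary k"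
      using k by (auto simp: unit_cube_def cube_boundary_def)
    have e: "?H t w = sphere_concat k (\<lambda>x. F (t, x)) (\<lambda>x. G (t, x)) sphere_base"
      if "w \<in> cube_boundary k" for w
      by (rule H[OF t subsetD[OF cube_boundary_subset that], unfolded cube_to_sphere_boundary[OF that]])
    have c: "cube_to_sphere k ((\<lambda>_. 0)(0 := 2 * 0)) = sphere_base"
      by (intro cube_to_sphere_boundary cube_boundary_update_end z k) simp
    have "sphere_concat k (\<lambda>x. F (t, x)) (\<lambda>x. G (t, x)) sphere_base = snd Y"
      using e[OF z(2), unfolded c F(4)[OF t]] by simp
    with e[OF y] show "?H t y = snd Y" by (rule trans)
  qed (use H[of 0] H[of 1] F G in simp_all)
qed

section \<open>The group laws\<close>

lemma pmap_sphere_concat: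
  "\<lbrakk>0 < k; pmap (psphere k) Y f; pmap (psphere k) Y g\<rbrakk> \<Longrightarrow> pmap (psphere k) Y (sphere_concat k f g)"
  by (meson phomotopic_imp_pmap phomotopic_refl phomotopic_sphere_concat)

lemma carrier_homotopy_group: "carrier (homotopy_group k Y) = HTop (psphere k) Y"
  by (simp add: homotopy_group_def)

text \<open>Reduces the union over representatives to a single pair, by homotopy invariance of
  concatenation.\<close>

lemma homotopy_group_mult_pclass:
  assumes k: "0 < k" and f: "pmap (psphere k) Y f" and g: "pmap (psphere k) Y g"
  shows "pclass (psphere k) Y f \<otimes>\<^bsub>homotopy_group k Y\<^esub> pclass (psphere k) Y g
    = pclass (psphere k) Y (sphere_concat k f g)"
proof -
  have "pclass (psphere k) Y (sphere_concat k f' g') = pclass (psphere k) Y (sphere_concat k f g)"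
    if "f' \<in> pclass (psphere k) Y f" "g' \<in> pclass (psphere k) Y g" for f' g'
    using that phomotopic_sphere_concat[OF k, of Y f f' g g'] pclass_eqI
    by (metis mem_Collect_eq pclass_def)
  then have "(\<Union>f'\<in>pclass (psphere k) Y f. \<Union>g'\<in>pclass (psphere k) Y g.
      pclass (psphere k) Y (sphere_concat k f' g')) = pclass (psphere k) Y (sphere_concat k f g)"
    using pclass_self[OF f] pclass_self[OF g] by blast
  then show ?thesis
    by (simp add: homotopy_group_def)
qed

lemma unit_cube_0: "\<lbrakk>y \<in> unit_cube k; 0 < k\<rbrakk> \<Longrightarrow> 0 \<le> y 0 \<and> y 0 \<le> 1"
  by (simp add: unit_cube_def)

text \<open>Both bracketings run through the same map at different speeds. The function
  \<open>b\<close> carries the breakpoints 1/2, 3/4 to 1/4, 1/2; its slopes 1/2, 1, 2 increase, so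
  it is the maximum of its three linear pieces.\<close>

lemma phomotopic_sphere_concat_assoc:
  assumes k: "0 < k"
    and f: "pmap (psphere k) Y f" and g: "pmap (psphere k) Y g" and h: "pmap (psphere k) Y h"
  shows "phomotopic (psphere k) Y (sphere_concat k (sphere_concat k f g) h)
           (sphere_concat k f (sphere_concat k g h))"
proof (rule phomotopic_reparametrization[OF k, where h = "sphere_concat k (sphere_concat k f g) h"
      and a = "\<lambda>x. x" and b = "\<lambda>x. max (x / 2) (max (x - 1/4) (2 * x - 1))"])
  let ?b = "\<lambda>x::real. max (x / 2) (max (x - 1/4) (2 * x - 1))"
  note pm = pmap_sphere_concat[OF k]
  show "pmap (psphere k) Y (sphere_concat k (sphere_concat k f g) h)"
    by (intro pm f g h)
  have base: "u sphere_base = snd Y" if "pmap (psphere k) Y u" for u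
    using that by (simp add: pmap_def)
  have cc: "sphere_concat k u v (cube_to_sphere k z) =
      (if z 0 \<le> 1/2 then u (cube_to_sphere k (z(0 := 2 * z 0)))
       else v (cube_to_sphere k (z(0 := 2 * z 0 - 1))))"
    if "pmap (psphere k) Y u" "pmap (psphere k) Y v" "z \<in> unit_cube k" for u v z
    using that by (intro sphere_concat_cube_to_sphere[where b = "snd Y"] k base)
  fix y assume y: "y \<in> unit_cube k"
  have y0: "0 \<le> y 0" "y 0 \<le> 1" using unit_cube_0[OF y k] by auto
  have upd: "y(0 := a) \<in> unit_cube k" if "0 \<le> a" "a \<le> 1" for a
    using unit_cube_update y k that by blast
  consider "y 0 \<le> 1/2" | "1/2 < y 0" "y 0 \<le> 3/4" | "3/4 < y 0" by linarith
  then show "sphere_concat k f (sphere_concat k g h) (cube_to_sphere k y) =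
      sphere_concat k (sphere_concat k f g) h (cube_to_sphere k (y(0 := ?b (y 0))))"
  proof cases
    case 1
    then have b: "?b (y 0) = y 0 / 2" by simp
    show ?thesis
      unfolding b using 1 y0 y by (simp add: cc upd pm f g h)
  next
    case 2
    then have b: "?b (y 0) = y 0 - 1/4" by simp
    show ?thesis
      unfolding b using 2 y0 y by (simp add: cc upd pm f g h)
  next
    case 3
    then have b: "?b (y 0) = 2 * y 0 - 1" by simp
    show ?thesis
      unfolding b using 3 y0 y by (simp add: cc upd pm f g h)
  qed
qed (auto intro!: continuous_intros simp: le_max_iff_disj)

text \<open>The constant half is \<open>f\<close> waiting at coordinate 0, which gives
  \<open>max 0 (2 * x - 1)\<close>.\<close>

lemma phomotopic_sphere_concat_const:
  assumes k: "0 < k" and f: "pmap (psphere k) Y f"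
  shows "phomotopic (psphere k) Y (sphere_concat k (\<lambda>_. snd Y) f) f"
proof (rule phomotopic_reparametrization[OF k f, where b = "\<lambda>x. x" and a = "\<lambda>x. max 0 (2 * x - 1)"])
  fix y assume y: "y \<in> unit_cube k"
  have base: "f sphere_base = snd Y" using f by (simp add: pmap_def)
  have "f (cube_to_sphere k (y(0 := 0))) = snd Y"
    using cube_to_sphere_boundary[OF cube_boundary_update_end[OF y k, of 0]] base by simp
  then show "sphere_concat k (\<lambda>_. snd Y) f (cube_to_sphere k y) =
      f (cube_to_sphere k (y(0 := max 0 (2 * y 0 - 1))))"
    using sphere_concat_cube_to_sphere[where f = "\<lambda>_. snd Y" and g = f, OF k refl base y]
    by (cases "y 0 \<le> 1/2") (simp_all add: max_absorb1 max_absorb2)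
qed (auto intro!: continuous_intros)

section \<open>Inverses by reflection\<close>

text \<open>Reversal flips the sign of the first \<open>c\<close> and leaves the squares, hence
  \<open>r\<close> and \<open>d\<close>, unchanged; that \<open>c\<close> appears in sphere
  coordinate 1. So an inverse is obtained by precomposing with a reflection of the sphere.\<close>

lemma cube_to_sphere_reverse:
  assumes "0 < k"
  shows "cube_to_sphere k (y(0 := 1 - y 0)) = (cube_to_sphere k y)(1 := - cube_to_sphere k y 1)"
proof -
  have sq: "(1 - 2 * (y(0 := 1 - y 0)) i)\<^sup>2 = (1 - 2 * y i)\<^sup>2" for i
    by (simp add: power2_eq_square algebra_simps)
  show ?thesis
    unfolding cube_to_sphere_def Let_def sq using assms
    by (auto simp: fun_eq_iff minus_divide_left algebra_simps)
qed

lemma pmap_reflection: "pmap (psphere k) (psphere k) (\<lambda>s. s(1 := - s 1))"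
proof -
  have "(\<Sum>i\<le>k. ((s(1 := - s 1)) i)\<^sup>2) = (\<Sum>i\<le>k. (s i)\<^sup>2)" for s :: "nat \<Rightarrow> real"
    by (rule sum.cong) auto
  then have "(\<lambda>s. s(1 := - s 1)) \<in> topspace (nsphere k) \<rightarrow> topspace (nsphere k)"
    by (auto simp: topspace_nsphere_iff simp del: fun_upd_apply) auto
  moreover have "continuous_on S (\<lambda>s::nat \<Rightarrow> real. s(1 := - s 1))" for S
    by (intro continuous_on_update continuous_intros continuous_on_subset[OF continuous_on_product_coordinates])
      auto
  ultimately have "continuous_map (nsphere k) (nsphere k) (\<lambda>s. s(1 := - s 1))"
    by (auto simp: nsphere_eq_top_of_set continuous_map_in_subtopology)
  then show ?thesis
    by (auto simp: pmap_def sphere_base_def)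
qed

text \<open>The concatenation traverses \<open>f\<close> from coordinate 1 back to 0 and out again,
  that is along \<open>\<bar>1 - 2 * x\<bar>\<close>. Both ends are at 1, so the path contracts to
  the constant 1, where \<open>f\<close> takes the base value.\<close>

lemma phomotopic_sphere_concat_reflection:
  assumes k: "0 < k" and f: "pmap (psphere k) Y f"
  shows "phomotopic (psphere k) Y (sphere_concat k (f \<circ> (\<lambda>s. s(1 := - s 1))) f) (\<lambda>_. snd Y)"
proof (rule phomotopic_reparametrization[OF k f, where b = "\<lambda>_. 1" and a = "\<lambda>x. \<bar>1 - 2 * x\<bar>"])
  fix y assume y: "y \<in> unit_cube k"
  have base: "f sphere_base = snd Y" using f by (simp add: pmap_def)
  then show "snd Y = f (cube_to_sphere k (y(0 := 1)))"
    using cube_to_sphere_boundary[OF cube_boundary_update_end[OF y k, of 1]] by simp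
  have base': "(f \<circ> (\<lambda>s. s(1 := - s 1))) sphere_base = snd Y"
    using pmap_compose[OF pmap_reflection f] by (simp add: pmap_def)
  have "(f \<circ> (\<lambda>s. s(1 := - s 1))) (cube_to_sphere k (y(0 := 2 * y 0)))
      = f (cube_to_sphere k (y(0 := 1 - 2 * y 0)))"
    using cube_to_sphere_reverse[OF k, of "y(0 := 2 * y 0)"] by simp
  then show "sphere_concat k (f \<circ> (\<lambda>s. s(1 := - s 1))) f (cube_to_sphere k y)
      = f (cube_to_sphere k (y(0 := \<bar>1 - 2 * y 0\<bar>)))"
    using sphere_concat_cube_to_sphere[where f = "f \<circ> (\<lambda>s. s(1 := - s 1))" and g = f,
        OF k base' base y] by (simp add: abs_if del: o_apply)
qed (auto intro!: continuous_intros)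

lemma pmap_const: "pointed_space Y \<Longrightarrow> pmap X Y (\<lambda>_. snd Y)"
  by (simp add: pmap_def pointed_space_def)

text \<open>A left unit and left inverses suffice for \<open>groupI\<close>, so only these are
  constructed.\<close>

lemma group_homotopy_group:
  assumes k: "0 < k" and Y: "pointed_space Y"
  shows "group (homotopy_group k Y)"
proof (rule groupI)
  let ?G = "homotopy_group k Y"
  note c = carrier_homotopy_group
  note pm = pmap_sphere_concat[OF k]
  note mult = homotopy_group_mult_pclass[OF k]
  have one: "\<one>\<^bsub>?G\<^esub> = pclass (psphere k) Y (\<lambda>_. snd Y)" by (simp add: homotopy_group_def)
  note const = pmap_const[OF Y, of "psphere k"]
  show "\<one>\<^bsub>?G\<^esub> \<in> carrier ?G" unfolding one c using const by (rule pclass_in_HTop)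
  show "A \<otimes>\<^bsub>?G\<^esub> B \<in> carrier ?G" if "A \<in> carrier ?G" "B \<in> carrier ?G" for A B
    using that unfolding c by (auto elim!: HTopE simp: mult intro!: pclass_in_HTop pm)
  show "A \<otimes>\<^bsub>?G\<^esub> B \<otimes>\<^bsub>?G\<^esub> C = A \<otimes>\<^bsub>?G\<^esub> (B \<otimes>\<^bsub>?G\<^esub> C)"
    if "A \<in> carrier ?G" "B \<in> carrier ?G" "C \<in> carrier ?G" for A B C
    using that unfolding c
    by (elim HTopE) (simp add: mult pm pclass_eqI[OF phomotopic_sphere_concat_assoc[OF k]])
  show "\<one>\<^bsub>?G\<^esub> \<otimes>\<^bsub>?G\<^esub> A = A" if "A \<in> carrier ?G" for A
    using that unfolding c one
    by (elim HTopE) (simp add: mult const pclass_eqI[OF phomotopic_sphere_concat_const[OF k]])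
  show "\<exists>B\<in>carrier ?G. B \<otimes>\<^bsub>?G\<^esub> A = \<one>\<^bsub>?G\<^esub>" if A: "A \<in> carrier ?G" for A
  proof -
    obtain f where f: "pmap (psphere k) Y f" "A = pclass (psphere k) Y f"
      using A unfolding c by (rule HTopE)
    let ?g = "f \<circ> (\<lambda>s. s(1 := - s 1))"
    have g: "pmap (psphere k) Y ?g" using pmap_reflection f(1) by (rule pmap_compose)
    have "pclass (psphere k) Y ?g \<otimes>\<^bsub>?G\<^esub> A = \<one>\<^bsub>?G\<^esub>"
      unfolding f(2) mult[OF g f(1)] one
      by (rule pclass_eqI[OF phomotopic_sphere_concat_reflection[OF k f(1)]])
    then show ?thesis unfolding c using pclass_in_HTop[OF g] by blast
  qed
qed

text \<open>An equality of functions, since \<open>h\<close> moves into both branches; this is what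
  makes induced maps homomorphisms.\<close>

lemma comp_sphere_concat: "h \<circ> sphere_concat k f g = sphere_concat k (h \<circ> f) (h \<circ> g)"
  by (simp add: sphere_concat_def Let_def fun_eq_iff)

lemma group_hom_hcomp:
  assumes k: "0 < k" and Y: "pointed_space Y" "pointed_space Z" and B: "B \<in> HTop Y Z"
  shows "group_hom (homotopy_group k Y) (homotopy_group k Z) (hcomp (psphere k) Z B)"
proof (intro group_hom.intro group_hom_axioms.intro group_homotopy_group k Y homI)
  obtain h where h: "pmap Y Z h" "B = pclass Y Z h" using B by (rule HTopE)
  fix A assume A: "A \<in> carrier (homotopy_group k Y)"
  then obtain f where f: "pmap (psphere k) Y f" "A = pclass (psphere k) Y f"
    unfolding carrier_homotopy_group by (rule HTopE)
  show "hcomp (psphere k) Z B A \<in> carrier (homotopy_group k Z)"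
    using A B unfolding carrier_homotopy_group by (rule hcomp_in_HTop)
  fix A' assume "A' \<in> carrier (homotopy_group k Y)"
  then obtain f' where f': "pmap (psphere k) Y f'" "A' = pclass (psphere k) Y f'"
    unfolding carrier_homotopy_group by (rule HTopE)
  show "hcomp (psphere k) Z B (A \<otimes>\<^bsub>homotopy_group k Y\<^esub> A') =
      hcomp (psphere k) Z B A \<otimes>\<^bsub>homotopy_group k Z\<^esub> hcomp (psphere k) Z B A'"
    using f(1) f'(1) h(1) k unfolding f(2) f'(2) h(2)
    by (simp add: homotopy_group_mult_pclass hcomp_pclass pmap_sphere_concat pmap_compose
        comp_sphere_concat)
qed

section \<open>Shape groups as inverse limits\<close>

lemma HPol_system_group_hom:
  assumes E: "HPol_system V E" and k: "0 < k"
    and lm: "l \<in> index E" "m \<in> index E" "ile E l m"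
  shows "group_hom (homotopy_group k (obj E m)) (homotopy_group k (obj E l))
    (hcomp (psphere k) (obj E l) (bond E l m))"
  using assms by (intro group_hom_hcomp) (auto simp: HPol_system_def HPol_def)

lemma HPol_system_group:
  assumes "HPol_system V E" "0 < k" "l \<in> index E"
  shows "group (homotopy_group k (obj E l))"
  using assms by (intro group_homotopy_group) (auto simp: HPol_system_def HPol_def)

text \<open>Phrased with carriers, so that the rules for groups and homomorphisms apply at each
  index.\<close>

lemma shape_mor_iff:
  "F \<in> shape_mor k E \<longleftrightarrow> F \<in> extensional (index E) \<and>
     (\<forall>l\<in>index E. F l \<in> carrier (homotopy_group k (obj E l))) \<and>
     (\<forall>l\<in>index E. \<forall>m\<in>index E. ile E l m \<longrightarrow> hcomp (psphere k) (obj E l) (bond E l m) (F m) = F l)"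
  by (auto simp: shape_mor_def carrier_homotopy_group PiE_def)

text \<open>Bonding homomorphisms commute with inverses, so compatibility survives.\<close>

lemma shape_mor_inverse:
  assumes E: "HPol_system V E" and k: "0 < k" and F: "F \<in> shape_mor k E"
  shows "(\<lambda>l\<in>index E. inv\<^bsub>homotopy_group k (obj E l)\<^esub> F l) \<in> shape_mor k E"
  unfolding shape_mor_iff
proof (intro conjI ballI impI)
  fix l m assume lm: "l \<in> index E" "m \<in> index E" "ile E l m"
  interpret group_hom "homotopy_group k (obj E m)" "homotopy_group k (obj E l)"
    "hcomp (psphere k) (obj E l) (bond E l m)"
    by (rule HPol_system_group_hom[OF E k lm])
  show "hcomp (psphere k) (obj E l) (bond E l m)
      ((\<lambda>l\<in>index E. inv\<^bsub>homotopy_group k (obj E l)\<^esub> F l) m)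
    = (\<lambda>l\<in>index E. inv\<^bsub>homotopy_group k (obj E l)\<^esub> F l) l"
    using F lm by (simp add: shape_mor_iff)
next
  fix l assume "l \<in> index E"
  then show "(\<lambda>l\<in>index E. inv\<^bsub>homotopy_group k (obj E l)\<^esub> F l) l
      \<in> carrier (homotopy_group k (obj E l))"
    using F group.inv_closed[OF HPol_system_group[OF E k]] by (simp add: shape_mor_iff)
qed simp

lemma carrier_shape_group: "carrier (shape_group k E) = shape_mor k E"
  by (simp add: shape_group_def)

lemma shape_group_mult_apply:
  "l \<in> index E \<Longrightarrow> (F \<otimes>\<^bsub>shape_group k E\<^esub> G) l = F l \<otimes>\<^bsub>homotopy_group k (obj E l)\<^esub> G l"
  by (simp add: shape_group_def)

lemma shape_mor_eqI:
  "\<lbrakk>F \<in> shape_mor k E; G \<in> shape_mor k E; \<And>l. l \<in> index E \<Longrightarrow> F l = G l\<rbrakk> \<Longrightarrow> F = G"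
  by (auto simp: shape_mor_iff intro: extensionalityI)

lemma shape_mor_mult:
  assumes E: "HPol_system V E" and k: "0 < k" and F: "F \<in> shape_mor k E" and G: "G \<in> shape_mor k E"
  shows "F \<otimes>\<^bsub>shape_group k E\<^esub> G \<in> shape_mor k E"
  unfolding shape_mor_iff
proof (intro conjI ballI impI)
  fix l m assume lm: "l \<in> index E" "m \<in> index E" "ile E l m"
  interpret group_hom "homotopy_group k (obj E m)" "homotopy_group k (obj E l)"
    "hcomp (psphere k) (obj E l) (bond E l m)"
    by (rule HPol_system_group_hom[OF E k lm])
  show "hcomp (psphere k) (obj E l) (bond E l m) ((F \<otimes>\<^bsub>shape_group k E\<^esub> G) m)
      = (F \<otimes>\<^bsub>shape_group k E\<^esub> G) l"
    using F G lm by (simp add: shape_mor_iff shape_group_mult_apply)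
next
  fix l assume l: "l \<in> index E"
  interpret group "homotopy_group k (obj E l)" by (rule HPol_system_group[OF E k l])
  show "(F \<otimes>\<^bsub>shape_group k E\<^esub> G) l \<in> carrier (homotopy_group k (obj E l))"
    using F G l by (simp add: shape_mor_iff shape_group_mult_apply)
qed (simp add: shape_group_def)

lemma shape_mor_one:
  assumes E: "HPol_system V E" and k: "0 < k"
  shows "\<one>\<^bsub>shape_group k E\<^esub> \<in> shape_mor k E"
  unfolding shape_mor_iff
proof (intro conjI ballI impI)
  fix l m assume lm: "l \<in> index E" "m \<in> index E" "ile E l m"
  interpret group_hom "homotopy_group k (obj E m)" "homotopy_group k (obj E l)"
    "hcomp (psphere k) (obj E l) (bond E l m)"
    by (rule HPol_system_group_hom[OF E k lm])
  show "hcomp (psphere k) (obj E l) (bond E l m) (\<one>\<^bsub>shape_group k E\<^esub> m) = \<one>\<^bsub>shape_group k E\<^esub> l"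
    using lm by (simp add: shape_group_def)
next
  fix l assume l: "l \<in> index E"
  interpret group "homotopy_group k (obj E l)" by (rule HPol_system_group[OF E k l])
  show "\<one>\<^bsub>shape_group k E\<^esub> l \<in> carrier (homotopy_group k (obj E l))"
    using l by (simp add: shape_group_def)
qed (simp add: shape_group_def)

lemma shape_mor_inverse_mult:
  assumes E: "HPol_system V E" and k: "0 < k" and F: "F \<in> shape_mor k E"
  shows "(\<lambda>l\<in>index E. inv\<^bsub>homotopy_group k (obj E l)\<^esub> F l) \<otimes>\<^bsub>shape_group k E\<^esub> F
    = \<one>\<^bsub>shape_group k E\<^esub>"
proof (rule shape_mor_eqI[where k = k])
  fix l assume l: "l \<in> index E"
  interpret group "homotopy_group k (obj E l)" by (rule HPol_system_group[OF E k l])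
  show "((\<lambda>l\<in>index E. inv\<^bsub>homotopy_group k (obj E l)\<^esub> F l) \<otimes>\<^bsub>shape_group k E\<^esub> F) l
      = \<one>\<^bsub>shape_group k E\<^esub> l"
    using l F by (simp add: shape_group_def shape_mor_iff)
qed (use assms in \<open>auto intro: shape_mor_mult shape_mor_inverse shape_mor_one\<close>)

lemma group_shape_group:
  assumes E: "HPol_system V E" and k: "0 < k"
  shows "group (shape_group k E)"
proof (rule groupI, unfold carrier_shape_group)
  let ?G = "shape_group k E"
  fix F G H assume F: "F \<in> shape_mor k E" and G: "G \<in> shape_mor k E" and H: "H \<in> shape_mor k E"
  show "F \<otimes>\<^bsub>?G\<^esub> G \<otimes>\<^bsub>?G\<^esub> H = F \<otimes>\<^bsub>?G\<^esub> (G \<otimes>\<^bsub>?G\<^esub> H)"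
  proof (rule shape_mor_eqI[where k = k])
    fix l assume l: "l \<in> index E"
    interpret group "homotopy_group k (obj E l)" by (rule HPol_system_group[OF E k l])
    show "(F \<otimes>\<^bsub>?G\<^esub> G \<otimes>\<^bsub>?G\<^esub> H) l = (F \<otimes>\<^bsub>?G\<^esub> (G \<otimes>\<^bsub>?G\<^esub> H)) l"
      using F G H l by (simp add: shape_group_mult_apply shape_mor_iff m_assoc)
  qed (intro shape_mor_mult[OF E k] F G H)+
next
  fix F assume F: "F \<in> shape_mor k E"
  show "\<one>\<^bsub>shape_group k E\<^esub> \<otimes>\<^bsub>shape_group k E\<^esub> F = F"
  proof (rule shape_mor_eqI[where k = k])
    fix l assume l: "l \<in> index E"
    interpret group "homotopy_group k (obj E l)" by (rule HPol_system_group[OF E k l])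
    show "(\<one>\<^bsub>shape_group k E\<^esub> \<otimes>\<^bsub>shape_group k E\<^esub> F) l = F l"
      using F l by (simp add: shape_group_def shape_mor_iff)
  qed (intro shape_mor_mult[OF E k] shape_mor_one[OF E k] F)+
  show "\<exists>G\<in>shape_mor k E. G \<otimes>\<^bsub>shape_group k E\<^esub> F = \<one>\<^bsub>shape_group k E\<^esub>"
    using shape_mor_inverse[OF E k F] shape_mor_inverse_mult[OF E k F] by blast
qed (intro shape_mor_mult[OF E k] shape_mor_one[OF E k]; assumption)+

text \<open>Shows that the inverse at \<open>l\<close> depends on \<open>F l\<close> alone, as
  continuity of inversion requires.\<close>

lemma shape_group_inv:
  assumes E: "HPol_system V E" and k: "0 < k" and F: "F \<in> shape_mor k E"
  shows "inv\<^bsub>shape_group k E\<^esub> F = (\<lambda>l\<in>index E. inv\<^bsub>homotopy_group k (obj E l)\<^esub> F l)"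
  using group.inv_equality[OF group_shape_group[OF E k] shape_mor_inverse_mult[OF E k F]]
    shape_mor_inverse[OF E k F] F
  by (simp add: carrier_shape_group)

section \<open>The shape topology\<close>

lemma HPol_system_directed:
  assumes "HPol_system V E"
  shows "index E \<noteq> {}"
    and "\<lbrakk>l \<in> index E; m \<in> index E\<rbrakk> \<Longrightarrow> \<exists>n\<in>index E. ile E l n \<and> ile E m n"
  using conjunct1[OF assms[unfolded HPol_system_def]] unfolding directed_set_def by blast+

text \<open>The bonding morphism recovers the value at \<open>l\<close> from the value at
  \<open>n\<close>.\<close>

lemma shape_nbhd_antimono:
  assumes "l \<in> index E" "n \<in> index E" "ile E l n" "F \<in> shape_mor k E"
  shows "shape_nbhd k E n F \<subseteq> shape_nbhd k E l F"
proof
  fix G assume "G \<in> shape_nbhd k E n F"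
  then have G: "G \<in> shape_mor k E" "F n = G n" by (simp_all add: shape_nbhd_def)
  have bond: "hcomp (psphere k) (obj E l) (bond E l n) (H n) = H l" if "H \<in> shape_mor k E" for H
    using that assms(1-3) by (simp add: shape_mor_iff)
  have "F l = G l" using bond[OF assms(4)] bond[OF G(1)] G(2) by simp
  then show "G \<in> shape_nbhd k E l F" using G(1) by (simp add: shape_nbhd_def)
qed

text \<open>Directedness makes the sets \<open>shape_nbhd k E l F\<close> a base: agreement at a common upper bound of
  two indices implies agreement at both.\<close>

lemma openin_shape_topology:
  assumes E: "HPol_system V E"
  shows "openin (shape_topology k E) U \<longleftrightarrow>
    U \<subseteq> shape_mor k E \<and> (\<forall>F\<in>U. \<exists>l\<in>index E. shape_nbhd k E l F \<subseteq> U)"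
proof -
  let ?B = "\<lambda>U. \<exists>F\<in>shape_mor k E. \<exists>l\<in>index E. U = shape_nbhd k E l F"
  have nb: "(arbitrary union_of ?B) U \<longleftrightarrow>
      U \<subseteq> shape_mor k E \<and> (\<forall>F\<in>U. \<exists>l\<in>index E. shape_nbhd k E l F \<subseteq> U)" for U
  proof -
    have "(arbitrary union_of ?B) U \<longleftrightarrow> (\<forall>F\<in>U. \<exists>V. ?B V \<and> F \<in> V \<and> V \<subseteq> U)"
      by (rule arbitrary_union_of_alt)
    also have "\<dots> \<longleftrightarrow> U \<subseteq> shape_mor k E \<and> (\<forall>F\<in>U. \<exists>l\<in>index E. shape_nbhd k E l F \<subseteq> U)"
    proof (intro iffI conjI subsetI ballI)
      fix F assume *: "\<forall>F\<in>U. \<exists>V. ?B V \<and> F \<in> V \<and> V \<subseteq> U" and F: "F \<in> U"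
      then obtain G l where G: "G \<in> shape_mor k E" "l \<in> index E"
        "F \<in> shape_nbhd k E l G" "shape_nbhd k E l G \<subseteq> U" by blast
      then show "F \<in> shape_mor k E" by (simp add: shape_nbhd_def)
      \<comment> \<open>Agreement at \<open>l\<close> is an equivalence relation, so every member of
        a basic set may serve as its centre.\<close>
      have "shape_nbhd k E l F = shape_nbhd k E l G"
        using G(3) by (simp add: shape_nbhd_def)
      then show "\<exists>l\<in>index E. shape_nbhd k E l F \<subseteq> U" using G by blast
    next
      fix F assume *: "U \<subseteq> shape_mor k E \<and> (\<forall>F\<in>U. \<exists>l\<in>index E. shape_nbhd k E l F \<subseteq> U)"
        and F: "F \<in> U"
      then obtain l where "l \<in> index E" "shape_nbhd k E l F \<subseteq> U" by blast
      moreover have "F \<in> shape_mor k E" "F \<in> shape_nbhd k E l F"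
        using * F by (auto simp: shape_nbhd_def)
      ultimately show "\<exists>V. ?B V \<and> F \<in> V \<and> V \<subseteq> U" by blast
    qed
    finally show ?thesis .
  qed
  have "istopology (arbitrary union_of ?B)"
    unfolding istopology_base_alt
  proof (intro allI impI)
    fix S T assume ST: "(arbitrary union_of ?B) S \<and> (arbitrary union_of ?B) T"
    note S = conjunct1[OF ST, unfolded nb] and T = conjunct2[OF ST, unfolded nb]
    have "\<exists>n\<in>index E. shape_nbhd k E n F \<subseteq> S \<inter> T" if F: "F \<in> S \<inter> T" for F
    proof -
      obtain l m where l: "l \<in> index E" "shape_nbhd k E l F \<subseteq> S"
        and m: "m \<in> index E" "shape_nbhd k E m F \<subseteq> T"
        using S T F by blast
      obtain n where n: "n \<in> index E" "ile E l n" "ile E m n"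
        using HPol_system_directed(2)[OF E l(1) m(1)] by blast
      have "F \<in> shape_mor k E" using S F by blast
      then have "shape_nbhd k E n F \<subseteq> shape_nbhd k E l F \<inter> shape_nbhd k E m F"
        using shape_nbhd_antimono l(1) m(1) n by (metis Int_subset_iff)
      then show ?thesis using l m n(1) by blast
    qed
    then show "(arbitrary union_of ?B) (S \<inter> T)"
      unfolding nb using S by blast
  qed
  then show ?thesis
    unfolding shape_topology_def by (simp add: topology_inverse' nb)
qed

lemma topspace_shape_topology:
  assumes E: "HPol_system V E"
  shows "topspace (shape_topology k E) = shape_mor k E"
proof -
  have "openin (shape_topology k E) (shape_mor k E)"
    unfolding openin_shape_topology[OF E] using HPol_system_directed(1)[OF E]
    by (auto simp: shape_nbhd_def)
  then show ?thesis
    using openin_shape_topology[OF E, of k "topspace (shape_topology k E)"] openin_subset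
    by fastforce
qed

lemma openin_shape_nbhd:
  assumes "HPol_system V E" "l \<in> index E"
  shows "openin (shape_topology k E) (shape_nbhd k E l F)"
  using assms by (auto simp: openin_shape_topology shape_nbhd_def)

lemma topological_group_shape_group:
  assumes E: "HPol_system V E" and k: "0 < k"
  shows "topological_group (shape_group k E) (shape_topology k E)"
proof -
  let ?G = "shape_group k E" and ?T = "shape_topology k E"
  note top = topspace_shape_topology[OF E]
  have "continuous_map (prod_topology ?T ?T) ?T (\<lambda>(a, b). a \<otimes>\<^bsub>?G\<^esub> b)"
    unfolding continuous_map
  proof (intro conjI allI impI)
    show "(\<lambda>(a, b). a \<otimes>\<^bsub>?G\<^esub> b) ` topspace (prod_topology ?T ?T) \<subseteq> topspace ?T"
      using shape_mor_mult[OF E k] by (auto simp: top)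
    fix U assume U: "openin ?T U"
    show "openin (prod_topology ?T ?T)
        {z \<in> topspace (prod_topology ?T ?T). (case z of (a, b) \<Rightarrow> a \<otimes>\<^bsub>?G\<^esub> b) \<in> U}"
      unfolding openin_prod_topology_alt
    proof (intro allI impI)
      fix a b
      assume "(a, b) \<in> {z \<in> topspace (prod_topology ?T ?T). (case z of (a, b) \<Rightarrow> a \<otimes>\<^bsub>?G\<^esub> b) \<in> U}"
      then have a: "a \<in> shape_mor k E" and b: "b \<in> shape_mor k E" and ab: "a \<otimes>\<^bsub>?G\<^esub> b \<in> U"
        by (auto simp: top)
      obtain l where l: "l \<in> index E" "shape_nbhd k E l (a \<otimes>\<^bsub>?G\<^esub> b) \<subseteq> U"
        using U ab unfolding openin_shape_topology[OF E] by blast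
      \<comment> \<open>The product at \<open>l\<close> uses only the factors at \<open>l\<close>,
        so one index works for both factors and the product.\<close>
      have "a' \<otimes>\<^bsub>?G\<^esub> b' \<in> shape_nbhd k E l (a \<otimes>\<^bsub>?G\<^esub> b)"
        if "a' \<in> shape_nbhd k E l a" "b' \<in> shape_nbhd k E l b" for a' b'
        using that shape_mor_mult[OF E k] l(1) by (simp add: shape_nbhd_def shape_group_mult_apply)
      then have "shape_nbhd k E l a \<times> shape_nbhd k E l b
          \<subseteq> {z \<in> topspace (prod_topology ?T ?T). (case z of (a, b) \<Rightarrow> a \<otimes>\<^bsub>?G\<^esub> b) \<in> U}"
        using l(2) by (auto simp: top) (auto simp: shape_nbhd_def)
      moreover have "a \<in> shape_nbhd k E l a" "b \<in> shape_nbhd k E l b"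
        using a b by (auto simp: shape_nbhd_def)
      ultimately show "\<exists>A B. openin ?T A \<and> openin ?T B \<and> a \<in> A \<and> b \<in> B \<and>
          A \<times> B \<subseteq> {z \<in> topspace (prod_topology ?T ?T). (case z of (a, b) \<Rightarrow> a \<otimes>\<^bsub>?G\<^esub> b) \<in> U}"
        using openin_shape_nbhd[OF E l(1)] by blast
    qed
  qed
  moreover have "continuous_map ?T ?T (\<lambda>a. inv\<^bsub>?G\<^esub> a)"
    unfolding continuous_map
  proof (intro conjI allI impI)
    note inv = shape_group_inv[OF E k]
    have closed: "inv\<^bsub>?G\<^esub> a \<in> shape_mor k E" if "a \<in> shape_mor k E" for a
      using shape_mor_inverse[OF E k that] inv[OF that] by simp
    then show "(\<lambda>a. inv\<^bsub>?G\<^esub> a) ` topspace ?T \<subseteq> topspace ?T" by (auto simp: top)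
    fix U assume U: "openin ?T U"
    show "openin ?T {a \<in> topspace ?T. inv\<^bsub>?G\<^esub> a \<in> U}"
      unfolding openin_shape_topology[OF E] top
    proof (intro conjI ballI)
      fix a assume a: "a \<in> {a \<in> shape_mor k E. inv\<^bsub>?G\<^esub> a \<in> U}"
      then obtain l where l: "l \<in> index E" "shape_nbhd k E l (inv\<^bsub>?G\<^esub> a) \<subseteq> U"
        using U unfolding openin_shape_topology[OF E] by blast
      have "inv\<^bsub>?G\<^esub> b \<in> shape_nbhd k E l (inv\<^bsub>?G\<^esub> a)" if "b \<in> shape_nbhd k E l a" for b
        using that a l(1) closed[of b] inv[of a] inv[of b] by (simp add: shape_nbhd_def)
      then have "shape_nbhd k E l a \<subseteq> {a \<in> shape_mor k E. inv\<^bsub>?G\<^esub> a \<in> U}"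
        using l(2) by (auto simp: shape_nbhd_def)
      then show "\<exists>l\<in>index E. shape_nbhd k E l a \<subseteq> {a \<in> shape_mor k E. inv\<^bsub>?G\<^esub> a \<in> U}"
        using l(1) by blast
    qed blast
  qed
  ultimately show ?thesis
    unfolding topological_group_def
    using group_shape_group[OF E k] by (simp add: top carrier_shape_group)
qed

theorem theorem3p1:
  fixes X :: "'a pspace" and E :: "('i, 'b) inv_sys" and p :: "'i \<Rightarrow> ('a \<Rightarrow> 'b) set" and k :: nat
  assumes "pointed_space X"
    and "HPol_expansion TYPE('v) X E p"
    and "1 \<le> k"
  shows "topological_group (shape_group k E) (shape_topology k E)"
proof (rule topological_group_shape_group)
  show "HPol_system TYPE('v) E"
    using assms(2) unfolding HPol_expansion_def by (rule conjunct1)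
  show "0 < k" using assms(3) by simp
qed

end
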